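(* For any finite set $A$ and any coefficient group $G$, there is a natural isomorphism $$H_*(C(A),G)\cong H_*(K(A),G)$$ between the homology of the complex of complete partitions $C(A)$ and the homology of the complex of connected graphs $K(A)$.
   Context: Let $A$ be a finite set with $k$ elements. $\Delta(A)$ is the simplex whose vertices correspond to the two-element subsets of $A$; a face is identified with the graph on vertex set $A$ whose edges are the corresponding two-element subsets; a graph is connected if any two points of $A$ are joined by a chain of its edges; $M(A)$ is the subcomplex of faces with non-connected graphs, and $K(A)=\Delta(A)/M(A)$ (quotient chain complex). $\nabla(A)$ is the simplex with $2^{k-1}-1$ vertices, in one-to-one correspondence with the unordered partitions of $A$ into two nonempty subsets. A face of $\nabla(A)$ is called non-complete if there exist two elements $a,b\in A$ such that for every vertex of the face, $a$ and $b$ lie in the same part of the corresponding partition. The non-complete faces form a subcomplex $\Omega(A)$, and $C(A)=\nabla(A)/\Omega(A)$ (quotient chain complex). Chain complexes are augmented, the empty face being a face of dimension $-1$. *)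

theory Defs
  imports "HOL-Algebra.Coset" "HOL-Algebra.FiniteProduct" "HOL-Combinatorics.Permutations" "HOL-Library.Disjoint_Sets"
begin

section \<open>Augmented oriented simplicial chains with coefficients in a group\<close>

text \<open>
  A (finite) simplicial complex is given by the set \<open>X\<close> of its faces, each face being the set of
  its vertices; the empty face is a face like any other. Degrees are integers: a face with \<open>m\<close>
  vertices has degree \<open>m - 1\<close>, so that the empty face has degree \<open>-1\<close>.

  An \<open>n\<close>-chain with coefficients in the abelian group \<open>G\<close> (written multiplicatively, as in
  HOL-Algebra) is an alternating function on the ordered faces: \<open>c [v\<^sub>0, \<dots>, v\<^sub>n]\<close> is the coefficient
  of the oriented simplex \<open>[v\<^sub>0, \<dots>, v\<^sub>n]\<close>, and it is neutral off the \<open>n\<close>-dimensional faces of \<open>X\<close>.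
  Finite support is automatic, as only complexes with finitely many vertices are considered.
\<close>

definition simp_chains ::
  "('g, 'm) monoid_scheme \<Rightarrow> 'v set set \<Rightarrow> int \<Rightarrow> ('v list \<Rightarrow> 'g) monoid" where
  "simp_chains G X n =
     \<lparr>carrier = {c. (\<forall>vs. c vs \<in> carrier G) \<and>
                    (\<forall>vs. c vs \<noteq> \<one>\<^bsub>G\<^esub> \<longrightarrow>
                        distinct vs \<and> set vs \<in> X \<and> int (length vs) = n + 1) \<and>
                    (\<forall>vs p. p permutes {..<length vs} \<longrightarrow>
                        c (permute_list p vs) = c vs [^]\<^bsub>G\<^esub> sign p)},
      monoid.mult = (\<lambda>c d vs. c vs \<otimes>\<^bsub>G\<^esub> d vs),
      one = (\<lambda>_. \<one>\<^bsub>G\<^esub>)\<rparr>"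

text \<open>
  This is the usual boundary, sending \<open>[v\<^sub>0, \<dots>, v\<^sub>n]\<close> to the alternating sum of its facets: the
  simplices having \<open>[w\<^sub>1, \<dots>, w\<^sub>n]\<close> as a facet are those on \<open>v, w\<^sub>1, \<dots>, w\<^sub>n\<close> for a further vertex \<open>v\<close>,
  and in the boundary of \<open>[v, w\<^sub>1, \<dots>, w\<^sub>n]\<close> the facet \<open>[w\<^sub>1, \<dots>, w\<^sub>n]\<close> has sign \<open>+1\<close>. (If \<open>v\<close> is
  among the \<open>w\<^sub>i\<close>, or the list spans no face, then \<open>c\<close> is neutral there.) On \<open>0\<close>-chains it is the
  augmentation.
\<close>

definition simp_boundary ::
  "('g, 'm) monoid_scheme \<Rightarrow> 'v set set \<Rightarrow> ('v list \<Rightarrow> 'g) \<Rightarrow> ('v list \<Rightarrow> 'g)" where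
  "simp_boundary G X c = (\<lambda>ws. \<Otimes>\<^bsub>G\<^esub>v\<in>\<Union>X. c (v # ws))"

text \<open>
  The chain map of a vertex map \<open>\<phi>\<close>: it sends \<open>[v\<^sub>0, \<dots>, v\<^sub>n]\<close> to \<open>[\<phi> v\<^sub>0, \<dots>, \<phi> v\<^sub>n]\<close> if the \<open>\<phi> v\<^sub>i\<close> are
  distinct, and to zero otherwise.
\<close>

definition simp_push ::
  "('g, 'm) monoid_scheme \<Rightarrow> 'v set set \<Rightarrow> ('v \<Rightarrow> 'w) \<Rightarrow> ('v list \<Rightarrow> 'g) \<Rightarrow> ('w list \<Rightarrow> 'g)" where
  "simp_push G X \<phi> c =
     (\<lambda>ws. if distinct ws then \<Otimes>\<^bsub>G\<^esub>vs\<in>{vs. set vs \<subseteq> \<Union>X \<and> map \<phi> vs = ws}. c vs else \<one>\<^bsub>G\<^esub>)"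


section \<open>Quotient complexes and their homology\<close>

text \<open>
  The map between quotients induced by a homomorphism \<open>f\<close> into \<open>H\<close>, where \<open>N\<close> is the subgroup of
  \<open>H\<close> factored out. When \<open>f\<close> respects the subgroups, all cosets in the union coincide.
\<close>

definition coset_map :: "('b, 'm) monoid_scheme \<Rightarrow> 'b set \<Rightarrow> ('a \<Rightarrow> 'b) \<Rightarrow> 'a set \<Rightarrow> 'b set" where
  "coset_map H N f = (\<lambda>S. \<Union>x\<in>S. N #>\<^bsub>H\<^esub> f x)"

definition quot_chains ::
  "('g, 'm) monoid_scheme \<Rightarrow> 'v set set \<Rightarrow> 'v set set \<Rightarrow> int \<Rightarrow> ('v list \<Rightarrow> 'g) set monoid" where
  "quot_chains G X Y n = simp_chains G X n Mod carrier (simp_chains G Y n)"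

definition quot_map ::
  "('g, 'm) monoid_scheme \<Rightarrow> 'v set set \<Rightarrow> 'v set set \<Rightarrow> int \<Rightarrow> ('c \<Rightarrow> ('v list \<Rightarrow> 'g)) \<Rightarrow>
   'c set \<Rightarrow> ('v list \<Rightarrow> 'g) set" where
  "quot_map G X Y n f = coset_map (simp_chains G X n) (carrier (simp_chains G Y n)) f"

text \<open>The boundary leaving degree \<open>n\<close>.\<close>

definition quot_boundary ::
  "('g, 'm) monoid_scheme \<Rightarrow> 'v set set \<Rightarrow> 'v set set \<Rightarrow> int \<Rightarrow>
   ('v list \<Rightarrow> 'g) set \<Rightarrow> ('v list \<Rightarrow> 'g) set" where
  "quot_boundary G X Y n = quot_map G X Y (n - 1) (simp_boundary G X)"

definition quot_cycles ::
  "('g, 'm) monoid_scheme \<Rightarrow> 'v set set \<Rightarrow> 'v set set \<Rightarrow> int \<Rightarrow> ('v list \<Rightarrow> 'g) set monoid" where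
  "quot_cycles G X Y n =
     (quot_chains G X Y n)
       \<lparr>carrier := kernel (quot_chains G X Y n) (quot_chains G X Y (n - 1))
                          (quot_boundary G X Y n)\<rparr>"

definition quot_boundaries ::
  "('g, 'm) monoid_scheme \<Rightarrow> 'v set set \<Rightarrow> 'v set set \<Rightarrow> int \<Rightarrow> ('v list \<Rightarrow> 'g) set set" where
  "quot_boundaries G X Y n = quot_boundary G X Y (n + 1) ` carrier (quot_chains G X Y (n + 1))"

definition quot_homology ::
  "('g, 'm) monoid_scheme \<Rightarrow> 'v set set \<Rightarrow> 'v set set \<Rightarrow> int \<Rightarrow> ('v list \<Rightarrow> 'g) set set monoid" where
  "quot_homology G X Y n = quot_cycles G X Y n Mod quot_boundaries G X Y n"

text \<open>
  The map into \<open>quot_homology G X Y n\<close> induced by a chain map \<open>f\<close> with values in the chains of \<open>X\<close>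
  over \<open>G\<close>.
\<close>

definition quot_homology_map ::
  "('g, 'm) monoid_scheme \<Rightarrow> 'v set set \<Rightarrow> 'v set set \<Rightarrow> int \<Rightarrow> ('c \<Rightarrow> ('v list \<Rightarrow> 'g)) \<Rightarrow>
   'c set set \<Rightarrow> ('v list \<Rightarrow> 'g) set set" where
  "quot_homology_map G X Y n f =
     coset_map (quot_cycles G X Y n) (quot_boundaries G X Y n) (quot_map G X Y n f)"


section \<open>The complex of connected graphs\<close>

definition two_subsets :: "'a set \<Rightarrow> 'a set set" where
  "two_subsets A = {e. e \<subseteq> A \<and> card e = 2}"

definition connected_graph :: "'a set \<Rightarrow> 'a set set \<Rightarrow> bool" where
  "connected_graph A E \<longleftrightarrow> (\<forall>a\<in>A. \<forall>b\<in>A. (a, b) \<in> {(x, y). {x, y} \<in> E}\<^sup>*)"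

definition graph_simplex :: "'a set \<Rightarrow> 'a set set set" where
  "graph_simplex A = Pow (two_subsets A)"

definition nonconnected_graphs :: "'a set \<Rightarrow> 'a set set set" where
  "nonconnected_graphs A = {E \<in> graph_simplex A. \<not> connected_graph A E}"

definition K_homology ::
  "('g, 'm) monoid_scheme \<Rightarrow> 'a set \<Rightarrow> int \<Rightarrow> ('a set list \<Rightarrow> 'g) set set monoid" where
  "K_homology G A n = quot_homology G (graph_simplex A) (nonconnected_graphs A) n"

text \<open>Functoriality in the set (\<open>f\<close> maps \<open>A\<close> bijectively onto \<open>B\<close>) and in the coefficients
  (\<open>h\<close> is a homomorphism into \<open>G\<close>).\<close>

definition K_bij_map ::
  "('g, 'm) monoid_scheme \<Rightarrow> 'a set \<Rightarrow> 'b set \<Rightarrow> ('a \<Rightarrow> 'b) \<Rightarrow> int \<Rightarrow>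
   ('a set list \<Rightarrow> 'g) set set \<Rightarrow> ('b set list \<Rightarrow> 'g) set set" where
  "K_bij_map G A B f n =
     quot_homology_map G (graph_simplex B) (nonconnected_graphs B) n
       (simp_push G (graph_simplex A) (image f))"

definition K_coeff_map ::
  "('g, 'm) monoid_scheme \<Rightarrow> ('f \<Rightarrow> 'g) \<Rightarrow> 'a set \<Rightarrow> int \<Rightarrow>
   ('a set list \<Rightarrow> 'f) set set \<Rightarrow> ('a set list \<Rightarrow> 'g) set set" where
  "K_coeff_map G h A n =
     quot_homology_map G (graph_simplex A) (nonconnected_graphs A) n (\<lambda>c. h \<circ> c)"


section \<open>The complex of complete partitions\<close>

definition bipartitions :: "'a set \<Rightarrow> 'a set set set" where
  "bipartitions A = {P. partition_on A P \<and> card P = 2}"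

definition non_complete :: "'a set \<Rightarrow> 'a set set set \<Rightarrow> bool" where
  "non_complete A S \<longleftrightarrow> (\<exists>a\<in>A. \<exists>b\<in>A. a \<noteq> b \<and> (\<forall>P\<in>S. \<exists>U\<in>P. a \<in> U \<and> b \<in> U))"

definition partition_simplex :: "'a set \<Rightarrow> 'a set set set set" where
  "partition_simplex A = Pow (bipartitions A)"

definition non_complete_faces :: "'a set \<Rightarrow> 'a set set set set" where
  "non_complete_faces A = {S \<in> partition_simplex A. non_complete A S}"

definition C_homology ::
  "('g, 'm) monoid_scheme \<Rightarrow> 'a set \<Rightarrow> int \<Rightarrow> ('a set set list \<Rightarrow> 'g) set set monoid" where
  "C_homology G A n = quot_homology G (partition_simplex A) (non_complete_faces A) n"

definition C_bij_map ::
  "('g, 'm) monoid_scheme \<Rightarrow> 'a set \<Rightarrow> 'b set \<Rightarrow> ('a \<Rightarrow> 'b) \<Rightarrow> int \<Rightarrow>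
   ('a set set list \<Rightarrow> 'g) set set \<Rightarrow> ('b set set list \<Rightarrow> 'g) set set" where
  "C_bij_map G A B f n =
     quot_homology_map G (partition_simplex B) (non_complete_faces B) n
       (simp_push G (partition_simplex A) (image (image f)))"

definition C_coeff_map ::
  "('g, 'm) monoid_scheme \<Rightarrow> ('f \<Rightarrow> 'g) \<Rightarrow> 'a set \<Rightarrow> int \<Rightarrow>
   ('a set set list \<Rightarrow> 'f) set set \<Rightarrow> ('a set set list \<Rightarrow> 'g) set set" where
  "C_coeff_map G h A n =
     quot_homology_map G (partition_simplex A) (non_complete_faces A) n (\<lambda>c. h \<circ> c)"

end

theory Submission
  imports Defs
begin

text \<open>
  The proof is Dowker duality. Relate an edge to a bipartition when some part contains the edge:
  \<open>M(A)\<close> consists of the sets of edges having a common related bipartition, and \<open>\<Omega>(A)\<close> of the sets of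
  bipartitions having a common related edge. Let \<open>Z\<close> be the complex of all \<open>\<sigma> \<squnion> \<tau>\<close> with every edge of
  \<open>\<sigma>\<close> related to every bipartition of \<open>\<tau>\<close>. The faces of \<open>Z\<close> with \<open>\<sigma> \<in> M(A)\<close> form an acyclic
  subcomplex, because over each \<open>\<sigma>\<close> the possible \<open>\<tau>\<close> form a full nonempty simplex, and dividing \<open>Z\<close>
  by it leaves \<open>K(A)\<close>. Hence restricting cycles of \<open>Z\<close> to the edges induces an isomorphism onto the
  homology of \<open>K(A)\<close>; by symmetry restricting them to the bipartitions gives that of \<open>C(A)\<close>. Both
  restrictions involve no choices, so the resulting isomorphism is natural.
\<close>

section \<open>Alternating chains\<close>

text \<open>Restricting cycles of \<open>Z\<close> to the edges does not commute with the boundary: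
  a mixed face \<sigma> \<squnion> {w} has the facet \<sigma>, which consists of edges alone. But
  then \<open>w\<close> is related to all of \<sigma>, so \<sigma> lies in M(A), and the error
  disappears exactly in the quotient K(A). No connecting map is involved, so degrees do not shift.
  Going back is where choices arise: lifting a relative cycle to a cycle of \<open>Z\<close> needs a
  filling inside the acyclic subcomplex, and its cone points depend on \<sigma>. So no inverse chain
  map is constructed. It is enough that both restrictions are surjective onto homology and have the
  same kernel, the boundaries of \<open>Z\<close>; the isomorphism may then use any lift.
  Augmentation matters: the empty face is coned off like every other face, so acyclicity holds in
  all degrees. If A has at most one point, there are no edges and no bipartitions, M(A) and
  \<Omega>(A) have no faces at all, \<open>Z\<close> is the empty face alone, and the argument
  applies unchanged.\<close>

abbreviation chains :: "('g, 'm) monoid_scheme \<Rightarrow> 'v set set \<Rightarrow> int \<Rightarrow> ('v list \<Rightarrow> 'g) set" where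
  "chains G X n \<equiv> carrier (simp_chains G X n)"

lemma permute_list_transpose:
  "permute_list (Transposition.transpose (length xs) (Suc (length xs + length ms))) (xs @ a # ms @ b # ys) = xs @ b # ms @ a # ys"
proof (rule nth_equalityI)
  fix i assume i: "i < length (permute_list (Transposition.transpose (length xs) (Suc (length xs + length ms))) (xs @ a # ms @ b # ys))"
  have "Transposition.transpose (length xs) (Suc (length xs + length ms)) permutes {..<length (xs @ a # ms @ b # ys)}"
    by (intro permutes_swap_id) auto
  with i show "permute_list (Transposition.transpose (length xs) (Suc (length xs + length ms))) (xs @ a # ms @ b # ys) ! i
      = (xs @ b # ms @ a # ys) ! i"
    by (auto simp: permute_list_nth nth_append nth_Cons' Transposition.transpose_def)
qed simp

lemma split_list_two:
  assumes "i < j" "j < length vs"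
  obtains xs a ms b ys where "vs = xs @ a # ms @ b # ys" "i = length xs" "j = Suc (length xs + length ms)"
proof
  have "vs = take i vs @ vs ! i # drop (Suc i) vs"
    using assms by (simp add: id_take_nth_drop)
  moreover have "drop (Suc i) vs = take (j - Suc i) (drop (Suc i) vs) @ vs ! j # drop (Suc j) vs"
    using assms id_take_nth_drop[of "j - Suc i" "drop (Suc i) vs"] by simp
  ultimately show "vs = take i vs @ vs ! i # take (j - Suc i) (drop (Suc i) vs) @ vs ! j # drop (Suc j) vs"
    by metis
qed (use assms in auto)

context comm_group
begin

text \<open>Exchanging \<open>a\<close> and \<open>b\<close> across \<open>m # ms\<close> amounts to
  exchanging \<open>a\<close> with \<open>m\<close>, then \<open>a\<close> with \<open>b\<close>
  across \<open>ms\<close>, then \<open>m\<close> with \<open>b\<close>: three signs, hence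
  one.\<close>

lemma alternating_swap:
  assumes "\<And>vs. c vs \<in> carrier G"
    and "\<And>xs a b ys. c (xs @ a # b # ys) = inv c (xs @ b # a # ys)"
  shows "c (xs @ a # ms @ b # ys) = inv c (xs @ b # ms @ a # ys)"
proof (induction ms arbitrary: xs)
  case Nil
  then show ?case using assms(2)[of xs a b ys] by simp
next
  case (Cons m ms)
  have "c (xs @ a # m # ms @ b # ys) = inv c ((xs @ [m]) @ a # ms @ b # ys)"
    using assms(2)[of xs a m "ms @ b # ys"] by simp
  also have "\<dots> = inv (inv c (xs @ m # b # ms @ a # ys))"
    using Cons[of "xs @ [m]"] by simp
  also have "\<dots> = inv c (xs @ b # m # ms @ a # ys)"
    using assms(1) assms(2)[of xs m b "ms @ a # ys"] by simp
  finally show ?case by simp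
qed

text \<open>Transpositions generate all permutations and adjacent ones generate the transpositions.
  Every later construction of a chain therefore has only a single exchange of neighbours to
  check.\<close>

lemma alternating_iff_adjacent:
  fixes c :: "'v list \<Rightarrow> 'a"
  assumes "\<And>vs. c vs \<in> carrier G"
  shows "(\<forall>vs p. p permutes {..<length vs} \<longrightarrow> c (permute_list p vs) = c vs [^] sign p) \<longleftrightarrow>
    (\<forall>xs a b ys. c (xs @ a # b # ys) = inv c (xs @ b # a # ys))" (is "?L \<longleftrightarrow> ?R")
proof
  assume L: ?L
  show ?R
  proof (intro allI)
    fix xs ys :: "'v list" and a b
    let ?p = "Transposition.transpose (length xs) (Suc (length xs))"
    have "?p permutes {..<length (xs @ b # a # ys)}"
      by (intro permutes_swap_id) auto
    then have "c (permute_list ?p (xs @ b # a # ys)) = c (xs @ b # a # ys) [^] sign ?p"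
      using L by blast
    then show "c (xs @ a # b # ys) = inv c (xs @ b # a # ys)"
      using permute_list_transpose[of xs "[]" b a ys] assms by (simp add: sign_swap_id int_pow_neg)
  qed
next
  assume R: ?R
  show ?L
  proof (intro allI impI)
    fix vs :: "'v list" and p
    assume "p permutes {..<length vs}"
    \<comment> \<open>All lists of this length are treated at once, because the induction hypothesis
      is applied to the list already permuted by the transposition.\<close>
    from this finite_lessThan have "\<forall>us. length us = length vs \<longrightarrow> c (permute_list p us) = c us [^] sign p"
    proof (induction rule: permutes_induct)
      case id
      then show ?case using assms by (simp add: int_pow_1)
    next
      case (swap a b p)
      have tr: "c (permute_list (Transposition.transpose a b) us) = inv c us"
        if us: "length us = length vs" for us
      proof -
        have *: "c (permute_list (Transposition.transpose i j) us) = inv c us" if ij: "i < j" "j < length us" for i j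
        proof -
          obtain xs x ms y ys where "us = xs @ x # ms @ y # ys" "i = length xs" "j = Suc (length xs + length ms)"
            by (rule split_list_two[OF ij])
          moreover have "c (xs @ y # ms @ x # ys) = inv c (xs @ x # ms @ y # ys)"
            by (rule alternating_swap) (use assms R in blast)+
          ultimately show ?thesis
            by (simp only: permute_list_transpose)
        qed
        show ?thesis
          using *[of a b] *[of b a] swap.hyps us by (metis lessThan_iff linorder_neqE_nat transpose_commute)
      qed
      have perm: "permutation (Transposition.transpose a b)" "permutation p"
        using permutes_imp_permutation[OF _ swap.hyps(4)] permutation_swap_id by simp_all
      have "c (permute_list (Transposition.transpose a b \<circ> p) us) = c us [^] sign (Transposition.transpose a b \<circ> p)"
        if us: "length us = length vs" for us
      proof -
        have "c (permute_list (Transposition.transpose a b \<circ> p) us) = (inv c us) [^] sign p"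
          using us swap by (simp add: permute_list_compose tr)
        also have "\<dots> = c us [^] sign (Transposition.transpose a b \<circ> p)"
          using swap.hyps assms by (simp add: sign_compose perm sign_swap_id int_pow_inv int_pow_neg)
        finally show ?thesis .
      qed
      then show ?case by blast
    qed
    then show "c (permute_list p vs) = c vs [^] sign p" by blast
  qed
qed

lemma chains_iff:
  "c \<in> chains G X n \<longleftrightarrow> (\<forall>vs. c vs \<in> carrier G) \<and>
     (\<forall>vs. c vs \<noteq> \<one> \<longrightarrow> distinct vs \<and> set vs \<in> X \<and> int (length vs) = n + 1) \<and>
     (\<forall>xs a b ys. c (xs @ a # b # ys) = inv c (xs @ b # a # ys))"
  using alternating_iff_adjacent[of c] unfolding simp_chains_def
  by (simp only: partial_object.select_convs mem_Collect_eq) blast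

lemma chainsI:
  assumes "\<And>vs. c vs \<in> carrier G"
    and "\<And>vs. c vs \<noteq> \<one> \<Longrightarrow> distinct vs" "\<And>vs. c vs \<noteq> \<one> \<Longrightarrow> set vs \<in> X"
    and "\<And>vs. c vs \<noteq> \<one> \<Longrightarrow> int (length vs) = n + 1"
    and "\<And>xs a b ys. c (xs @ a # b # ys) = inv c (xs @ b # a # ys)"
  shows "c \<in> chains G X n"
  using assms unfolding chains_iff by blast

lemma
  assumes "c \<in> chains G X n"
  shows chains_closed: "c vs \<in> carrier G"
    and chains_distinct: "c vs \<noteq> \<one> \<Longrightarrow> distinct vs"
    and chains_face: "c vs \<noteq> \<one> \<Longrightarrow> set vs \<in> X"
    and chains_length: "c vs \<noteq> \<one> \<Longrightarrow> int (length vs) = n + 1"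
    and chains_swap: "c (xs @ a # b # ys) = inv c (xs @ b # a # ys)"
    and chains_swap_hd: "c (a # b # ys) = inv c (b # a # ys)"
  using assms append_Nil unfolding chains_iff by (blast, blast, blast, blast, blast, metis append_Nil)

lemma chains_mono: "c \<in> chains G X n \<Longrightarrow> X \<subseteq> Y \<Longrightarrow> c \<in> chains G Y n"
  unfolding chains_iff by blast

lemma chains_one: "(\<lambda>_. \<one>) \<in> chains G X n"
  unfolding chains_iff by simp

lemma chains_mult:
  assumes c: "c \<in> chains G X n" and d: "d \<in> chains G X n"
  shows "(\<lambda>vs. c vs \<otimes> d vs) \<in> chains G X n"
proof (rule chainsI)
  fix vs assume "c vs \<otimes> d vs \<noteq> \<one>"
  then have "c vs \<noteq> \<one> \<or> d vs \<noteq> \<one>" by auto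
  then show "distinct vs" "set vs \<in> X" "int (length vs) = n + 1"
    using chains_distinct[OF c] chains_face[OF c] chains_length[OF c]
      chains_distinct[OF d] chains_face[OF d] chains_length[OF d] by metis+
next
  show "c (xs @ a # b # ys) \<otimes> d (xs @ a # b # ys) = inv (c (xs @ b # a # ys) \<otimes> d (xs @ b # a # ys))" for xs a b ys
    using chains_swap[OF c, of xs a] chains_swap[OF d, of xs a] chains_closed[OF c] chains_closed[OF d]
    by (simp only: inv_mult)
qed (use chains_closed[OF c] chains_closed[OF d] in simp)

lemma chains_inv:
  assumes c: "c \<in> chains G X n"
  shows "(\<lambda>vs. inv c vs) \<in> chains G X n"
proof (rule chainsI)
  fix vs assume "inv c vs \<noteq> \<one>"
  then have "c vs \<noteq> \<one>" by force
  then show "distinct vs" "set vs \<in> X" "int (length vs) = n + 1"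
    using chains_distinct[OF c] chains_face[OF c] chains_length[OF c] by simp_all
next
  show "inv c (xs @ a # b # ys) = inv (inv c (xs @ b # a # ys))" for xs a b ys
    using chains_swap[OF c, of xs a b ys] by simp
qed (use chains_closed[OF c] in simp)

lemma chains_mult_eq: "c \<otimes>\<^bsub>simp_chains G X n\<^esub> d = (\<lambda>vs. c vs \<otimes> d vs)"
  by (simp add: simp_chains_def)

lemma chains_one_eq: "\<one>\<^bsub>simp_chains G X n\<^esub> = (\<lambda>_. \<one>)"
  by (simp add: simp_chains_def)

lemma chains_comm_group: "comm_group (simp_chains G X n)"
proof (rule comm_groupI)
  fix c assume c: "c \<in> chains G X n"
  have "(\<lambda>vs. inv c vs) \<otimes>\<^bsub>simp_chains G X n\<^esub> c = \<one>\<^bsub>simp_chains G X n\<^esub>"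
    using chains_closed[OF c] by (simp add: chains_mult_eq chains_one_eq)
  then show "\<exists>d\<in>chains G X n. d \<otimes>\<^bsub>simp_chains G X n\<^esub> c = \<one>\<^bsub>simp_chains G X n\<^esub>"
    using chains_inv[OF c] by blast
qed (use chains_closed[of _ X n] in
    \<open>auto simp: chains_mult_eq chains_one_eq m_ac intro: chains_mult chains_one\<close>)

lemma chains_inv_eq:
  assumes "c \<in> chains G X n"
  shows "inv\<^bsub>simp_chains G X n\<^esub> c = (\<lambda>vs. inv c vs)"
proof -
  interpret C: comm_group "simp_chains G X n" by (rule chains_comm_group)
  have "(\<lambda>vs. inv c vs) \<otimes>\<^bsub>simp_chains G X n\<^esub> c = \<one>\<^bsub>simp_chains G X n\<^esub>"
    using chains_closed[OF assms] by (simp add: chains_mult_eq chains_one_eq)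
  then show ?thesis
    using C.inv_equality assms chains_inv by blast
qed

lemma chains_subgroup:
  assumes "Y \<subseteq> X"
  shows "subgroup (chains G Y n) (simp_chains G X n)"
proof (rule group.subgroupI)
  show "Group.group (simp_chains G X n)"
    by (rule comm_group.axioms(2)[OF chains_comm_group])
  show "chains G Y n \<subseteq> chains G X n"
    using assms chains_mono by blast
  then show "inv\<^bsub>simp_chains G X n\<^esub> c \<in> chains G Y n" if "c \<in> chains G Y n" for c
    using that chains_inv[OF that] chains_inv_eq[of c X n] by (simp add: subset_iff)
  show "chains G Y n \<noteq> {}"
    using chains_one by blast
qed (simp add: chains_mult_eq chains_mult)

section \<open>Boundary\<close>

text \<open>Antisymmetry of \<open>f\<close> alone would not do: \<open>G\<close> may have elements of order two.\<close>

lemma finprod_finprod_alternating: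
  assumes "finite U" "\<And>u v. f u v \<in> carrier G" "\<And>u v. f u v = inv f v u" "\<And>u. f u u = \<one>"
  shows "(\<Otimes>u\<in>U. \<Otimes>v\<in>U. f u v) = \<one>"
  using assms(1)
proof induction
  case empty
  then show ?case by simp
next
  case (insert a U)
  have cl: "(\<lambda>v. f u v) \<in> U \<rightarrow> carrier G" "(\<lambda>u. f u v) \<in> U \<rightarrow> carrier G" for u v
    using assms(2) by auto
  \<comment> \<open>The row and the column that \<open>a\<close> adds to the square cancel factor by
    factor.\<close>
  have cancel: "(\<Otimes>v\<in>U. f a v) \<otimes> (\<Otimes>u\<in>U. f u a) = \<one>"
  proof -
    have "(\<Otimes>v\<in>U. f a v) \<otimes> (\<Otimes>u\<in>U. f u a) = (\<Otimes>v\<in>U. f a v \<otimes> f v a)"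
      using cl by (simp add: finprod_multf)
    also have "\<dots> = \<one>"
      using assms(2) by (intro finprod_one_eqI) (metis assms(3) r_inv)
    finally show ?thesis .
  qed
  have row: "(\<Otimes>v\<in>insert a U. f u v) = f u a \<otimes> (\<Otimes>v\<in>U. f u v)" for u
    using insert.hyps assms(2) by (simp add: finprod_insert Pi_def)
  have "(\<Otimes>u\<in>insert a U. \<Otimes>v\<in>insert a U. f u v)
      = (\<Otimes>v\<in>insert a U. f a v) \<otimes> (\<Otimes>u\<in>U. \<Otimes>v\<in>insert a U. f u v)"
    using insert.hyps assms(2) by (subst finprod_insert) (auto intro!: finprod_closed)
  also have "\<dots> = (\<Otimes>v\<in>U. f a v) \<otimes> (\<Otimes>u\<in>U. f u a \<otimes> (\<Otimes>v\<in>U. f u v))"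
    using cl by (simp add: assms(4) row finprod_closed del: finprod_insert)
  also have "\<dots> = (\<Otimes>v\<in>U. f a v) \<otimes> ((\<Otimes>u\<in>U. f u a) \<otimes> (\<Otimes>u\<in>U. \<Otimes>v\<in>U. f u v))"
    using assms(2) by (subst finprod_multf) (auto simp: Pi_def finprod_closed)
  also have "\<dots> = \<one>"
    using cl cancel insert.IH by simp
  finally show ?case .
qed

lemma boundary_closed: "c \<in> chains G X n \<Longrightarrow> simp_boundary G Y c ws \<in> carrier G"
  unfolding simp_boundary_def using chains_closed[of c X n] by (auto intro!: finprod_closed)

lemma boundary_nontrivial:
  assumes "c \<in> chains G X n" "simp_boundary G Y c ws \<noteq> \<one>"
  obtains v where "v \<in> \<Union>Y" "c (v # ws) \<noteq> \<one>"
  using assms finprod_one_eqI[of "\<Union>Y" "\<lambda>v. c (v # ws)"] unfolding simp_boundary_def by blast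

lemma finprod_inv:
  assumes "\<And>x. x \<in> A \<Longrightarrow> f x \<in> carrier G"
  shows "(\<Otimes>x\<in>A. inv f x) = inv (\<Otimes>x\<in>A. f x)"
proof -
  have "(\<Otimes>x\<in>A. inv f x) \<otimes> (\<Otimes>x\<in>A. f x) = (\<Otimes>x\<in>A. inv f x \<otimes> f x)"
    using assms by (subst finprod_multf) auto
  also have "\<dots> = \<one>"
    using assms by (intro finprod_one_eqI) auto
  finally show ?thesis
    using assms by (intro inv_equality[symmetric]) (auto intro: finprod_closed)
qed

text \<open>The vertices multiplied over come from \<open>Y\<close>, independently of
  \<open>X\<close>, so that the boundary of a large complex can be applied to the chains of a
  subcomplex.\<close>

lemma boundary_chains:
  assumes "c \<in> chains G X n" and down: "\<And>F F'. F \<in> X \<Longrightarrow> F' \<subseteq> F \<Longrightarrow> F' \<in> X"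
  shows "simp_boundary G Y c \<in> chains G X (n - 1)"
proof (rule chainsI)
  note c = assms(1)
  fix vs
  show "simp_boundary G Y c vs \<in> carrier G"
    using boundary_closed[OF c] .
  assume "simp_boundary G Y c vs \<noteq> \<one>"
  then obtain v where "c (v # vs) \<noteq> \<one>"
    using boundary_nontrivial[OF c] by blast
  then show "distinct vs" "set vs \<in> X" "int (length vs) = n - 1 + 1"
    using chains_distinct[OF c] chains_face[OF c] chains_length[OF c] down by fastforce+
next
  fix xs a b ys
  have "simp_boundary G Y c (xs @ a # b # ys) = (\<Otimes>v\<in>\<Union>Y. inv c (v # xs @ b # a # ys))"
    unfolding simp_boundary_def
    using chains_swap[OF assms(1), of "_ # xs" a b ys] by simp
  then show "simp_boundary G Y c (xs @ a # b # ys) = inv simp_boundary G Y c (xs @ b # a # ys)"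
    using chains_closed[OF assms(1)] unfolding simp_boundary_def by (simp add: finprod_inv)
qed

lemma boundary_mult:
  assumes "c \<in> chains G X n" "d \<in> chains G X' n'"
  shows "simp_boundary G Y (\<lambda>vs. c vs \<otimes> d vs) = (\<lambda>vs. simp_boundary G Y c vs \<otimes> simp_boundary G Y d vs)"
  using chains_closed[OF assms(1)] chains_closed[OF assms(2)]
  unfolding simp_boundary_def by (auto simp: finprod_multf)

lemma boundary_inv:
  assumes "c \<in> chains G X n"
  shows "simp_boundary G Y (\<lambda>vs. inv c vs) = (\<lambda>vs. inv simp_boundary G Y c vs)"
  using chains_closed[OF assms(1)] unfolding simp_boundary_def by (simp add: finprod_inv)

lemma boundary_boundary:
  assumes "c \<in> chains G X n" "finite (\<Union>Y)"
  shows "simp_boundary G Y (simp_boundary G Y c) = (\<lambda>_. \<one>)"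
proof
  fix ws
  show "simp_boundary G Y (simp_boundary G Y c) ws = \<one>"
    unfolding simp_boundary_def
  proof (rule finprod_finprod_alternating)
    show "c (u # u # ws) = \<one>" for u
      using chains_distinct[OF assms(1), of "u # u # ws"] by auto
    qed (use assms(2) chains_closed[OF assms(1)] chains_swap_hd[OF assms(1)] in blast)+
qed

end

section \<open>Cones and acyclicity\<close>

text \<open>
  The cone of \<open>s\<close> with apex \<open>w\<close>: up to alternation, its value at \<open>[w, v\<^sub>1, \<dots>, v\<^sub>n]\<close> is \<open>s [v\<^sub>1, \<dots>, v\<^sub>n]\<close>.
  It is alternating only when \<open>s\<close> is trivial on the lists containing \<open>w\<close>.
\<close>

primrec cone :: "('g, 'm) monoid_scheme \<Rightarrow> 'v \<Rightarrow> ('v list \<Rightarrow> 'g) \<Rightarrow> 'v list \<Rightarrow> 'g" where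
  "cone G w s [] = \<one>\<^bsub>G\<^esub>"
| "cone G w s (x # xs) = (if x = w then s xs else inv\<^bsub>G\<^esub> cone G w (\<lambda>ys. s (x # ys)) xs)"

context comm_group
begin

lemma cone_closed:
  assumes "\<And>vs. s vs \<in> carrier G"
  shows "cone G w s vs \<in> carrier G"
  using assms by (induction vs arbitrary: s) auto

lemma cone_inv:
  assumes "\<And>vs. s vs \<in> carrier G"
  shows "cone G w (\<lambda>vs. inv s vs) vs = inv cone G w s vs"
  using assms by (induction vs arbitrary: s) (auto simp: cone_closed)

lemma cone_swap:
  assumes "\<And>vs. s vs \<in> carrier G"
    and "\<And>xs a b ys. s (xs @ a # b # ys) = inv s (xs @ b # a # ys)"
    and "\<And>ys. w \<in> set ys \<Longrightarrow> s ys = \<one>"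
  shows "cone G w s (xs @ a # b # ys) = inv cone G w s (xs @ b # a # ys)"
  using assms
proof (induction xs arbitrary: s)
  case Nil
  have "cone G w (\<lambda>vs. s (a # b # vs)) ys = inv cone G w (\<lambda>vs. s (b # a # vs)) ys"
    using Nil(2)[of "[]" a b] Nil(1) cone_inv[of "\<lambda>vs. s (b # a # vs)" w ys] by simp
  \<comment> \<open>For \<open>a = b = w\<close> both sides come from \<open>s (w # ys)\<close>,
    which need not equal its own inverse; here the triviality of \<open>s\<close> on lists
    containing \<open>w\<close> enters.\<close>
  then show ?case
    using Nil(1) Nil(3)[of "w # ys"] by (auto simp: cone_closed)
next
  case (Cons x xs)
  have "cone G w (\<lambda>vs. s (x # vs)) (xs @ a # b # ys) = inv cone G w (\<lambda>vs. s (x # vs)) (xs @ b # a # ys)"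
  proof (rule Cons.IH)
    show "s (x # xs @ a # b # ys) = inv s (x # xs @ b # a # ys)" for xs a b ys
      using Cons.prems(2)[of "x # xs" a b ys] by simp
  qed (use Cons.prems(1,3) in simp_all)
  then show ?case
    using Cons.prems(1) Cons.prems(2)[of xs a b ys] by (simp add: cone_closed)
qed

text \<open>The recursion walks to the first occurrence of \<open>w\<close> and there evaluates
  \<open>s\<close>, up to sign, on the list with that entry deleted. This locates the support of the
  cone.\<close>

lemma cone_nontrivial:
  assumes "cone G w s vs \<noteq> \<one>"
  obtains xs ys where "vs = xs @ w # ys" "w \<notin> set xs" "s (xs @ ys) \<noteq> \<one>"
  using assms
proof (induction vs arbitrary: s thesis)
  case (Cons x vs)
  show ?case
  proof (cases "x = w")
    case True
    then show ?thesis
      using Cons.prems(1)[of "[]" vs] Cons.prems(2) by simp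
  next
    case False
    then have "cone G w (\<lambda>ys. s (x # ys)) vs \<noteq> \<one>"
      using Cons.prems(2) by auto
    then obtain xs ys where "vs = xs @ w # ys" "w \<notin> set xs" "s (x # xs @ ys) \<noteq> \<one>"
      by (rule Cons.IH[rotated])
    then show ?thesis
      using Cons.prems(1)[of "x # xs" ys] False by simp
  qed
qed simp

lemma cone_chains:
  assumes s: "s \<in> chains G X n" and w: "\<And>ys. w \<in> set ys \<Longrightarrow> s ys = \<one>"
    and Y: "\<And>F. F \<in> X \<Longrightarrow> insert w F \<in> Y"
  shows "cone G w s \<in> chains G Y (n + 1)"
proof (rule chainsI)
  show "cone G w s vs \<in> carrier G" for vs
    by (intro cone_closed chains_closed[OF s])
  show "cone G w s (xs @ a # b # ys) = inv cone G w s (xs @ b # a # ys)" for xs a b ys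
    by (rule cone_swap) (use chains_closed[OF s] chains_swap[OF s] w in blast)+
  fix vs
  assume "cone G w s vs \<noteq> \<one>"
  then obtain xs ys where vs: "vs = xs @ w # ys" "s (xs @ ys) \<noteq> \<one>"
    by (rule cone_nontrivial)
  then have "w \<notin> set xs \<union> set ys"
    using w[of "xs @ ys"] by auto
  then show "distinct vs" "set vs \<in> Y" "int (length vs) = n + 1 + 1"
    using vs chains_distinct[OF s, of "xs @ ys"] chains_length[OF s, of "xs @ ys"] Y[of "set xs \<union> set ys"]
      chains_face[OF s, of "xs @ ys"]
    by auto
qed

text \<open>Each entry that \<open>w\<close> passes contributes a sign. Only whether the value is
  neutral matters later, so the total sign is left open.\<close>

lemma alternating_to_front:
  assumes "\<And>vs. c vs \<in> carrier G" "\<And>xs a b ys. c (xs @ a # b # ys) = inv c (xs @ b # a # ys)"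
  shows "c (xs @ w # ys) = c (w # xs @ ys) \<or> c (xs @ w # ys) = inv c (w # xs @ ys)"
  using assms
proof (induction xs arbitrary: c)
  case (Cons x xs)
  have "c (x # xs @ w # ys) = c (x # w # xs @ ys) \<or> c (x # xs @ w # ys) = inv c (x # w # xs @ ys)"
  proof (rule Cons.IH)
    show "c (x # xs @ a # b # ys) = inv c (x # xs @ b # a # ys)" for xs a b ys
      using Cons.prems(2)[of "x # xs" a b ys] by simp
  qed (use Cons.prems(1) in simp)
  then show ?case
    using Cons.prems(1) Cons.prems(2)[of "[]" x w "xs @ ys"] by auto
qed simp

text \<open>
  Subtracting from \<open>z\<close> the boundary of the cone over its part on the faces that contain \<open>\<sigma>\<close> but not \<open>w\<close>
  clears all faces above \<open>\<sigma>\<close>: those without \<open>w\<close> by construction, the others because \<open>z\<close> is a cycle.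
\<close>

lemma collapse:
  assumes U: "finite (\<Union>U)" "w \<in> \<Union>U"
    and down: "\<And>F F'. F \<in> X \<Longrightarrow> F' \<subseteq> F \<Longrightarrow> F' \<in> X"
    and w: "w \<notin> \<sigma>" "\<And>F. F \<in> X \<Longrightarrow> \<sigma> \<subseteq> F \<Longrightarrow> insert w F \<in> X"
    and z: "z \<in> chains G X n" "simp_boundary G U z = (\<lambda>_. \<one>)"
  obtains y where "y \<in> chains G X (n + 1)"
    "(\<lambda>vs. z vs \<otimes> inv simp_boundary G U y vs) \<in> chains G {F \<in> X. \<not> \<sigma> \<subseteq> F} n"
proof
  define s where "s = (\<lambda>vs. if \<sigma> \<subseteq> set vs \<and> w \<notin> set vs then z vs else \<one>)"
  have "s \<in> chains G {F \<in> X. \<sigma> \<subseteq> F} n"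
  proof (rule chainsI)
    fix vs assume "s vs \<noteq> \<one>"
    then have "z vs \<noteq> \<one>" "\<sigma> \<subseteq> set vs"
      by (auto simp: s_def split: if_splits)
    then show "distinct vs" "set vs \<in> {F \<in> X. \<sigma> \<subseteq> F}" "int (length vs) = n + 1"
      using chains_distinct[OF z(1)] chains_face[OF z(1)] chains_length[OF z(1)] by auto
  next
    show "s (xs @ a # b # ys) = inv s (xs @ b # a # ys)" for xs a b ys
      using chains_swap[OF z(1), of xs a b ys] by (simp add: s_def insert_commute)
  qed (simp add: s_def chains_closed[OF z(1)])
  moreover have s_w: "s vs = \<one>" if "w \<in> set vs" for vs
    using that by (simp add: s_def)
  moreover have "insert w F \<in> X" if "F \<in> {F \<in> X. \<sigma> \<subseteq> F}" for F
    using that w(2) by simp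
  ultimately show y: "cone G w s \<in> chains G X (n + 1)"
    by (rule cone_chains)
  define d where "d = (\<lambda>vs. z vs \<otimes> inv simp_boundary G U (cone G w s) vs)"
  have "simp_boundary G U (cone G w s) \<in> chains G X n"
    using boundary_chains[OF y, of U] down by simp
  then have d: "d \<in> chains G X n"
    unfolding d_def by (rule chains_mult[OF z(1) chains_inv])
  have sc: "s vs \<in> carrier G" for vs
    by (simp add: s_def chains_closed[OF z(1)])
  \<comment> \<open>At a list without \<open>w\<close>, only the factor with new vertex
    \<open>w\<close> can be nontrivial.\<close>
  have bd: "simp_boundary G U (cone G w s) vs = s vs" if w_notin: "w \<notin> set vs" for vs
  proof -
    have "cone G w (\<lambda>ys. s (v # ys)) vs = \<one>" for v
    proof (rule ccontr)
      assume "cone G w (\<lambda>ys. s (v # ys)) vs \<noteq> \<one>"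
      then obtain xs ys where "vs = xs @ w # ys" by (rule cone_nontrivial)
      then show False using w_notin by simp
    qed
    then have "cone G w s (v # vs) = (if v = w then s vs else \<one>)" for v
      by simp
    then have "simp_boundary G U (cone G w s) vs = (\<Otimes>v\<in>\<Union>U. if w = v then s vs else \<one>)"
      unfolding simp_boundary_def by (simp add: eq_commute)
    also have "\<dots> = s vs"
      using finprod_singleton[OF U(2,1), of "\<lambda>_. s vs"] sc by simp
    finally show ?thesis .
  qed
  \<comment> \<open>The cycle condition at \<open>ys\<close> solves for \<open>z (w # ys)\<close> as
    the inverse of the product of \<open>z (v # ys)\<close> over \<open>v\<close> other than
    \<open>w\<close>. The boundary of the cone at \<open>w # ys\<close> is the same product, since
    having \<open>v\<close> in front of \<open>w\<close> costs one sign.\<close>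
  have front: "d (w # ys) = \<one>" if \<sigma>: "\<sigma> \<subseteq> set (w # ys)" and X: "set (w # ys) \<in> X" for ys
  proof (cases "w \<in> set ys")
    case True
    then show ?thesis using chains_distinct[OF d, of "w # ys"] by auto
  next
    case False
    have \<sigma>': "\<sigma> \<subseteq> set ys" using \<sigma> w(1) by auto
    have "z (w # ys) \<otimes> (\<Otimes>v\<in>\<Union>U - {w}. z (v # ys)) = (\<Otimes>v\<in>insert w (\<Union>U - {w}). z (v # ys))"
      using U(1) chains_closed[OF z(1)] by (subst finprod_insert) auto
    also have "\<dots> = \<one>"
      using fun_cong[OF z(2), of ys] U(2) by (simp add: simp_boundary_def insert_absorb)
    finally have zw: "z (w # ys) = inv (\<Otimes>v\<in>\<Union>U - {w}. z (v # ys))"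
      using chains_closed[OF z(1)] by (intro inv_equality[symmetric]) (auto intro: finprod_closed)
    have "cone G w s (w # w # ys) = \<one>"
      using s_w[of "w # ys"] by simp
    moreover have "cone G w s (v # w # ys) = inv z (v # ys)" if "v \<noteq> w" for v
      using that False \<sigma>' by (auto simp: s_def)
    ultimately have "simp_boundary G U (cone G w s) (w # ys) = (\<Otimes>v\<in>insert w (\<Union>U - {w}). if v = w then \<one> else inv z (v # ys))"
      using U(2) unfolding simp_boundary_def by (auto simp: insert_absorb intro!: finprod_cong' chains_closed[OF z(1)])
    also have "\<dots> = (\<Otimes>v\<in>\<Union>U - {w}. if v = w then \<one> else inv z (v # ys))"
      using U(1) chains_closed[OF z(1)] by (subst finprod_insert) (auto intro!: finprod_closed)
    also have "\<dots> = (\<Otimes>v\<in>\<Union>U - {w}. inv z (v # ys))"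
      using chains_closed[OF z(1)] by (intro finprod_cong') auto
    also have "\<dots> = z (w # ys)"
      using chains_closed[OF z(1)] by (simp add: zw finprod_inv)
    finally show ?thesis
      using chains_closed[OF z(1)] by (simp add: d_def)
  qed
  have "\<not> \<sigma> \<subseteq> set vs" if "d vs \<noteq> \<one>" for vs
  proof
    assume \<sigma>: "\<sigma> \<subseteq> set vs"
    show False
    proof (cases "w \<in> set vs")
      case True
      then obtain xs ys where vs: "vs = xs @ w # ys"
        by (meson split_list)
      have "d (w # xs @ ys) = \<one>"
        using front[of "xs @ ys"] \<sigma> chains_face[OF d that] by (simp add: vs)
      moreover have "d vs = d (w # xs @ ys) \<or> d vs = inv d (w # xs @ ys)"
        unfolding vs by (rule alternating_to_front) (use chains_closed[OF d] chains_swap[OF d] in blast)+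
      ultimately show False using that by auto
    next
      case False
      then have "d vs = z vs \<otimes> inv s vs"
        unfolding d_def by (simp add: bd)
      also have "\<dots> = \<one>"
        using False \<sigma> chains_closed[OF z(1)] by (simp add: s_def)
      finally show False using that by simp
    qed
  qed
  then show "d \<in> chains G {F \<in> X. \<not> \<sigma> \<subseteq> F} n"
    using chains_closed[OF d] chains_distinct[OF d] chains_face[OF d] chains_length[OF d] chains_swap[OF d]
    by (intro chainsI) blast+
qed

text \<open>The faces with a fixed trace \<sigma> on \<open>T\<close> form a cone, but its apex
  varies with \<sigma>, so no single cone contracts \<open>X\<close>. The fibres are removed one at
  a time, from a maximal \<sigma> on: every face containing \<sigma> then has trace exactly
  \<sigma>, so one apex serves them all and \<open>collapse\<close> applies. What remains is a
  smaller complex of the same kind. \<open>U\<close> stays fixed so that the boundary does not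
  change while \<open>X\<close> shrinks.\<close>

lemma acyclic:
  assumes U: "finite (\<Union>U)" "\<Union>X \<subseteq> \<Union>U"
    and down: "\<And>F F'. F \<in> X \<Longrightarrow> F' \<subseteq> F \<Longrightarrow> F' \<in> X"
    and apex: "\<And>\<sigma>. \<sigma> \<in> X \<Longrightarrow> \<sigma> \<subseteq> T \<Longrightarrow> \<exists>w\<in>\<Union>U - T. \<forall>F\<in>X. F \<inter> T = \<sigma> \<longrightarrow> insert w F \<in> X"
    and z: "z \<in> chains G X n" "simp_boundary G U z = (\<lambda>_. \<one>)"
  shows "\<exists>y\<in>chains G X (n + 1). simp_boundary G U y = z"
proof -
  have "finite X"
    using U by (meson finite_UnionD finite_subset)
  then show ?thesis
    using assms(2-)
  proof (induction X arbitrary: z rule: finite_psubset_induct)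
    case (psubset X)
    show ?case
    proof (cases "X = {}")
      case True
      then have "z = (\<lambda>_. \<one>)"
        using chains_face[OF psubset.prems(4)] by blast
      then show ?thesis
        using chains_one psubset.prems(5) by metis
    next
      case False
      define S where "S = {\<sigma> \<in> X. \<sigma> \<subseteq> T}"
      \<comment> \<open>A nonempty complex has the empty face, so there is a trace to start
        from.\<close>
      have "finite S" "{} \<in> S"
        using psubset.hyps psubset.prems(2) False by (auto simp: S_def)
      then obtain \<sigma> where \<sigma>: "\<sigma> \<in> S" and max: "\<And>\<tau>. \<tau> \<in> S \<Longrightarrow> \<sigma> \<subseteq> \<tau> \<Longrightarrow> \<tau> = \<sigma>"
        using finite_has_maximal[of S] by auto
      then obtain w where w: "w \<in> \<Union>U - T" "\<And>F. F \<in> X \<Longrightarrow> F \<inter> T = \<sigma> \<Longrightarrow> insert w F \<in> X"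
        using psubset.prems(3)[of \<sigma>] by (auto simp: S_def)
      let ?X = "{F \<in> X. \<not> \<sigma> \<subseteq> F}"
      have apex_w: "insert w F \<in> X" if "F \<in> X" "\<sigma> \<subseteq> F" for F
      proof (rule w(2)[OF that(1)])
        have "F \<inter> T \<in> S"
          using that psubset.prems(2)[of F] by (auto simp: S_def)
        moreover have "\<sigma> \<subseteq> F \<inter> T"
          using that \<sigma> by (auto simp: S_def)
        ultimately show "F \<inter> T = \<sigma>" using max by simp
      qed
      have w': "w \<in> \<Union>U" "w \<notin> \<sigma>" using w(1) \<sigma> by (auto simp: S_def)
      have down: "F' \<in> X" if "F \<in> X" "F' \<subseteq> F" for F F'
        using psubset.prems(2)[OF that] .
      obtain y where y: "y \<in> chains G X (n + 1)"
        and zy: "(\<lambda>vs. z vs \<otimes> inv simp_boundary G U y vs) \<in> chains G ?X n"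
        using collapse[OF U(1) w'(1) down w'(2) apex_w psubset.prems(4,5)] .
      have "\<exists>x\<in>chains G ?X (n + 1). simp_boundary G U x = (\<lambda>vs. z vs \<otimes> inv simp_boundary G U y vs)"
      proof (rule psubset.IH[OF _ _ _ _ zy])
        show "?X \<subset> X" using \<sigma> by (auto simp: S_def)
        show "\<Union>?X \<subseteq> \<Union>U" using psubset.prems(1) by blast
        show "F' \<in> ?X" if "F \<in> ?X" "F' \<subseteq> F" for F F'
          using that psubset.prems(2)[of F F'] by auto
        \<comment> \<open>The old apex still works: \<sigma> lies in \<open>T\<close> and
          \<open>u\<close> outside it, so adding \<open>u\<close> cannot complete a face to one
          containing \<sigma>.\<close>
        show "\<exists>w\<in>\<Union>U - T. \<forall>F\<in>?X. F \<inter> T = \<tau> \<longrightarrow> insert w F \<in> ?X" if \<tau>: "\<tau> \<in> ?X" "\<tau> \<subseteq> T" for \<tau>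
        proof -
          obtain u where "u \<in> \<Union>U - T" "\<forall>F\<in>X. F \<inter> T = \<tau> \<longrightarrow> insert u F \<in> X"
            using psubset.prems(3) \<tau> by blast
          moreover have "\<sigma> \<subseteq> T" using \<sigma> by (simp add: S_def)
          ultimately show ?thesis by (intro bexI[of _ u]) auto
        qed
        have yb: "simp_boundary G U y \<in> chains G X n"
          using boundary_chains[OF y] psubset.prems(2) by simp
        show "simp_boundary G U (\<lambda>vs. z vs \<otimes> inv simp_boundary G U y vs) = (\<lambda>_. \<one>)"
          using boundary_mult[OF psubset.prems(4) chains_inv[OF yb]] boundary_inv[OF yb]
            boundary_boundary[OF y U(1)] psubset.prems(5)
          by simp
      qed
      then obtain x where x: "x \<in> chains G ?X (n + 1)" "simp_boundary G U x = (\<lambda>vs. z vs \<otimes> inv simp_boundary G U y vs)"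
        by blast
      have x': "x \<in> chains G X (n + 1)"
        using x(1) by (rule chains_mono) blast
      have "simp_boundary G U (\<lambda>vs. x vs \<otimes> y vs) = z"
        using boundary_mult[OF x' y, of U] boundary_closed[OF y] chains_closed[OF psubset.prems(4)]
        by (simp add: x(2) m_assoc)
      then show ?thesis
        using chains_mult[OF x' y] by blast
    qed
  qed
qed

end

section \<open>Classes of relative cycles\<close>

text \<open>Homology is built from cosets of cosets; this lets all later statements speak of a
  representing chain.\<close>

definition hclass ::
  "('g, 'm) monoid_scheme \<Rightarrow> 'v set set \<Rightarrow> 'v set set \<Rightarrow> int \<Rightarrow> ('v list \<Rightarrow> 'g) \<Rightarrow> ('v list \<Rightarrow> 'g) set set" where
  "hclass G X Y n c =
     quot_boundaries G X Y n #>\<^bsub>quot_cycles G X Y n\<^esub> (chains G Y n #>\<^bsub>simp_chains G X n\<^esub> c)"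

definition rel_cycles ::
  "('g, 'm) monoid_scheme \<Rightarrow> 'v set set \<Rightarrow> 'v set set \<Rightarrow> int \<Rightarrow> ('v list \<Rightarrow> 'g) set" where
  "rel_cycles G X Y n = {c \<in> chains G X n. simp_boundary G X c \<in> chains G Y (n - 1)}"

text \<open>Once the value is independent of the representative, the union in
  \<open>coset_map\<close> is one of identical sets, and nonemptiness of \<open>M\<close> keeps it
  from being empty.\<close>

lemma coset_map_r_coset:
  assumes "M \<noteq> {}" "\<And>m. m \<in> M \<Longrightarrow> N #>\<^bsub>H\<^esub> f (m \<otimes>\<^bsub>C\<^esub> c) = D"
  shows "coset_map H N f (M #>\<^bsub>C\<^esub> c) = D"
  using assms unfolding coset_map_def r_coset_def[of C] by auto

text \<open>Both \<open>H\<close> and \<open>H'\<close> are \<open>M\<close> modulo the same kernel.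
  The second conclusion shows that the choice in \<open>\<phi>\<close> is immaterial, and it is what
  naturality rests on.\<close>

lemma iso_common_kernel:
  fixes M :: "('a, 'm) monoid_scheme" and H :: "('b, 'k) monoid_scheme" and H' :: "('c, 'l) monoid_scheme"
  assumes \<alpha>: "group_hom M H \<alpha>" "\<alpha> ` carrier M = carrier H"
    and \<beta>: "group_hom M H' \<beta>" "\<beta> ` carrier M = carrier H'"
    and ker: "\<And>z. z \<in> carrier M \<Longrightarrow> \<alpha> z = \<one>\<^bsub>H\<^esub> \<longleftrightarrow> \<beta> z = \<one>\<^bsub>H'\<^esub>"
  defines "\<phi> \<equiv> \<lambda>x. \<beta> (SOME z. z \<in> carrier M \<and> \<alpha> z = x)"
  shows "\<phi> \<in> iso H H'" and "z \<in> carrier M \<Longrightarrow> \<phi> (\<alpha> z) = \<beta> z"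
proof -
  interpret \<alpha>: group_hom M H \<alpha> by fact
  interpret \<beta>: group_hom M H' \<beta> by fact
  have eq: "\<alpha> z = \<alpha> z' \<longleftrightarrow> \<beta> z = \<beta> z'" if "z \<in> carrier M" "z' \<in> carrier M" for z z'
  proof -
    have "\<alpha> z = \<alpha> z' \<longleftrightarrow> \<alpha> (z \<otimes>\<^bsub>M\<^esub> inv\<^bsub>M\<^esub> z') = \<one>\<^bsub>H\<^esub>"
      using that \<alpha>.H.r_cancel_one[of "\<alpha> z'" "\<alpha> z"]
      by (metis \<alpha>.G.inv_closed \<alpha>.H.group_l_invI \<alpha>.H.inv_equality \<alpha>.H.inv_inv \<alpha>.H.r_inv \<alpha>.hom_closed \<alpha>.hom_inv \<alpha>.hom_mult)
    also have "\<dots> \<longleftrightarrow> \<beta> (z \<otimes>\<^bsub>M\<^esub> inv\<^bsub>M\<^esub> z') = \<one>\<^bsub>H'\<^esub>"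
      using that by (intro ker) simp
    also have "\<dots> \<longleftrightarrow> \<beta> z = \<beta> z'"
      using that
      by (metis \<alpha>.G.inv_closed \<beta>.H.inv_equality \<beta>.H.inv_inv \<beta>.H.r_inv \<beta>.hom_closed \<beta>.hom_inv \<beta>.hom_mult)
    finally show ?thesis .
  qed
  have \<phi>: "\<phi> (\<alpha> z) = \<beta> z" if z: "z \<in> carrier M" for z
  proof -
    define z' where "z' = (SOME z'. z' \<in> carrier M \<and> \<alpha> z' = \<alpha> z)"
    have "z' \<in> carrier M \<and> \<alpha> z' = \<alpha> z"
      unfolding z'_def by (rule someI[of _ z]) (simp add: z)
    then show ?thesis
      using eq[of z' z] z by (simp add: \<phi>_def z'_def)
  qed
  then show "z \<in> carrier M \<Longrightarrow> \<phi> (\<alpha> z) = \<beta> z" .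
  have lift: "\<exists>z\<in>carrier M. x = \<alpha> z" if "x \<in> carrier H" for x
    using that \<alpha>(2) by blast
  show "\<phi> \<in> iso H H'"
  proof (rule isoI)
    show "\<phi> \<in> hom H H'"
    proof (rule homI)
      show "\<phi> x \<in> carrier H'" if "x \<in> carrier H" for x
        using lift[OF that] \<phi> by auto
      show "\<phi> (x \<otimes>\<^bsub>H\<^esub> y) = \<phi> x \<otimes>\<^bsub>H'\<^esub> \<phi> y" if xy: "x \<in> carrier H" "y \<in> carrier H" for x y
      proof -
        obtain u v where uv: "u \<in> carrier M" "x = \<alpha> u" "v \<in> carrier M" "y = \<alpha> v"
          using lift xy by metis
        then have "x \<otimes>\<^bsub>H\<^esub> y = \<alpha> (u \<otimes>\<^bsub>M\<^esub> v)" by simp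
        then show ?thesis
          using uv by (simp only: \<phi> \<beta>.hom_mult \<alpha>.G.m_closed)
      qed
    qed
    show "bij_betw \<phi> (carrier H) (carrier H')"
    proof (rule bij_betw_imageI)
      show "inj_on \<phi> (carrier H)"
      proof (rule inj_onI)
        fix x y assume "x \<in> carrier H" "y \<in> carrier H" and e: "\<phi> x = \<phi> y"
        then obtain u v where "u \<in> carrier M" "x = \<alpha> u" "v \<in> carrier M" "y = \<alpha> v"
          using lift by metis
        then show "x = y" using e eq[of u v] \<phi> by simp
      qed
      have "\<phi> ` carrier H = \<phi> ` \<alpha> ` carrier M"
        by (simp only: \<alpha>(2))
      also have "\<dots> = \<beta> ` carrier M"
        using \<phi> by force
      finally show "\<phi> ` carrier H = carrier H'"
        by (simp only: \<beta>(2))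
    qed
  qed
qed

section \<open>Homology of a pair of complexes, in terms of representing chains\<close>

locale complex_pair = comm_group G for G (structure) +
  fixes X Y :: "'v set set"
  assumes finite_vertices: "finite (\<Union>X)"
    and sub: "Y \<subseteq> X"
    and down_X: "F \<in> X \<Longrightarrow> F' \<subseteq> F \<Longrightarrow> F' \<in> X"
    and down_Y: "F \<in> Y \<Longrightarrow> F' \<subseteq> F \<Longrightarrow> F' \<in> Y"
begin

abbreviation cs :: "int \<Rightarrow> ('v list \<Rightarrow> 'a) \<Rightarrow> ('v list \<Rightarrow> 'a) set" where
  "cs n c \<equiv> chains G Y n #>\<^bsub>simp_chains G X n\<^esub> c"

sublocale C: comm_group "simp_chains G X n" for n
  by (rule chains_comm_group)

sublocale N: normal "chains G Y n" "simp_chains G X n" for n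
  using C.subgroup_imp_normal[OF chains_subgroup[OF sub]] .

lemma quot_comm_group: "comm_group (quot_chains G X Y n)"
  unfolding quot_chains_def using C.abelian_FactGroup[OF chains_subgroup[OF sub]] .

sublocale Q: comm_group "quot_chains G X Y n" for n
  by (rule quot_comm_group)

lemma quot_carrier: "carrier (quot_chains G X Y n) = cs n ` chains G X n"
  by (simp add: quot_chains_def carrier_FactGroup)

lemma cs_closed: "c \<in> chains G X n \<Longrightarrow> cs n c \<in> carrier (quot_chains G X Y n)"
  by (simp add: quot_carrier)

lemma cs_mult:
  assumes "c \<in> chains G X n" "d \<in> chains G X n"
  shows "cs n c \<otimes>\<^bsub>quot_chains G X Y n\<^esub> cs n d = cs n (\<lambda>vs. c vs \<otimes> d vs)"
  using N.rcos_sum[OF assms] by (simp add: quot_chains_def chains_mult_eq)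

lemma quot_one: "\<one>\<^bsub>quot_chains G X Y n\<^esub> = chains G Y n"
  by (simp add: quot_chains_def)

lemma cs_one_iff:
  assumes "c \<in> chains G X n"
  shows "cs n c = chains G Y n \<longleftrightarrow> c \<in> chains G Y n"
  using C.coset_join1[OF _ assms chains_subgroup[OF sub]] C.coset_join2[OF assms chains_subgroup[OF sub]] by blast

lemma cs_eqI:
  assumes "c \<in> chains G X n" "m \<in> chains G Y n"
  shows "cs n (\<lambda>vs. m vs \<otimes> c vs) = cs n c"
proof -
  have "cs n (\<lambda>vs. m vs \<otimes> c vs) = cs n m \<otimes>\<^bsub>quot_chains G X Y n\<^esub> cs n c"
    using assms chains_mono[OF assms(2) sub] by (simp add: cs_mult)
  also have "cs n m = \<one>\<^bsub>quot_chains G X Y n\<^esub>"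
    using assms(2) chains_mono[OF assms(2) sub] by (simp add: cs_one_iff quot_one)
  finally show ?thesis
    using assms(1) by (simp add: cs_closed)
qed

lemma boundary_X: "c \<in> chains G X n \<Longrightarrow> simp_boundary G X c \<in> chains G X (n - 1)"
  by (rule boundary_chains) (use down_X in blast)+

lemma boundary_X_Suc: "c \<in> chains G X (n + 1) \<Longrightarrow> simp_boundary G X c \<in> chains G X n"
  using boundary_X[of c "n + 1"] by simp

lemma boundary_Y: "c \<in> chains G Y n \<Longrightarrow> simp_boundary G X c \<in> chains G Y (n - 1)"
  by (rule boundary_chains) (use down_Y in blast)+

lemma quot_boundary_cs:
  assumes "c \<in> chains G X n"
  shows "quot_boundary G X Y n (cs n c) = cs (n - 1) (simp_boundary G X c)"
  unfolding quot_boundary_def quot_map_def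
proof (rule coset_map_r_coset)
  show "chains G Y n \<noteq> {}" using chains_one by blast
  fix m assume m: "m \<in> chains G Y n"
  then show "cs (n - 1) (simp_boundary G X (m \<otimes>\<^bsub>simp_chains G X n\<^esub> c)) = cs (n - 1) (simp_boundary G X c)"
    using assms by (simp add: chains_mult_eq boundary_mult[OF m assms] cs_eqI boundary_X boundary_Y)
qed

lemma quot_boundary_hom:
  "group_hom (quot_chains G X Y n) (quot_chains G X Y (n - 1)) (quot_boundary G X Y n)"
proof
  show "quot_boundary G X Y n \<in> hom (quot_chains G X Y n) (quot_chains G X Y (n - 1))"
  proof (rule homI)
    fix x y
    assume "x \<in> carrier (quot_chains G X Y n)"
    then obtain c where c: "c \<in> chains G X n" "x = cs n c"
      by (auto simp: quot_carrier)
    then show "quot_boundary G X Y n x \<in> carrier (quot_chains G X Y (n - 1))"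
      by (simp add: quot_boundary_cs cs_closed boundary_X)
    assume "y \<in> carrier (quot_chains G X Y n)"
    then obtain d where d: "d \<in> chains G X n" "y = cs n d"
      by (auto simp: quot_carrier)
    with c show "quot_boundary G X Y n (x \<otimes>\<^bsub>quot_chains G X Y n\<^esub> y) =
        quot_boundary G X Y n x \<otimes>\<^bsub>quot_chains G X Y (n - 1)\<^esub> quot_boundary G X Y n y"
      by (simp add: quot_boundary_cs boundary_X cs_mult chains_mult boundary_mult[OF c(1) d(1)])
  qed
qed

lemma cycles_carrier: "carrier (quot_cycles G X Y n) = cs n ` rel_cycles G X Y n"
proof -
  have eq: "quot_boundary G X Y n (cs n c) = chains G Y (n - 1) \<longleftrightarrow> simp_boundary G X c \<in> chains G Y (n - 1)"
    if "c \<in> chains G X n" for c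
    using that by (simp only: quot_boundary_cs cs_one_iff boundary_X)
  have carr: "carrier (quot_cycles G X Y n)
      = {x \<in> carrier (quot_chains G X Y n). quot_boundary G X Y n x = chains G Y (n - 1)}"
    by (simp add: quot_cycles_def kernel_def quot_one)
  have "carrier (quot_cycles G X Y n)
      = cs n ` {c \<in> chains G X n. quot_boundary G X Y n (cs n c) = chains G Y (n - 1)}"
    unfolding carr quot_carrier by blast
  also have "{c \<in> chains G X n. quot_boundary G X Y n (cs n c) = chains G Y (n - 1)} = rel_cycles G X Y n"
    unfolding rel_cycles_def by (rule Collect_cong) (simp add: eq cong: conj_cong)
  finally show ?thesis .
qed

lemma cycles_mult: "x \<otimes>\<^bsub>quot_cycles G X Y n\<^esub> y = x \<otimes>\<^bsub>quot_chains G X Y n\<^esub> y"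
  by (simp add: quot_cycles_def)

lemma cycles_subgroup: "subgroup (carrier (quot_cycles G X Y n)) (quot_chains G X Y n)"
  using group_hom.subgroup_kernel[OF quot_boundary_hom] by (simp add: quot_cycles_def)

lemma cycles_comm_group: "comm_group (quot_cycles G X Y n)"
proof (rule group.group_comm_groupI)
  show "Group.group (quot_cycles G X Y n)"
    using Q.subgroup_imp_group[OF cycles_subgroup[of n]] by (simp add: quot_cycles_def)
  show "x \<otimes>\<^bsub>quot_cycles G X Y n\<^esub> y = y \<otimes>\<^bsub>quot_cycles G X Y n\<^esub> x"
    if "x \<in> carrier (quot_cycles G X Y n)" "y \<in> carrier (quot_cycles G X Y n)" for x y
    using that subgroup.subset[OF cycles_subgroup[of n]] Q.m_comm[of x n y] by (simp add: cycles_mult subset_iff)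
qed

sublocale Z: comm_group "quot_cycles G X Y n" for n
  by (rule cycles_comm_group)

lemma boundaries_eq: "quot_boundaries G X Y n = (\<lambda>e. cs n (simp_boundary G X e)) ` chains G X (n + 1)"
  unfolding quot_boundaries_def using quot_boundary_cs[of _ "n + 1"]
  by (force simp: quot_carrier)

lemma boundary_rel_cycle:
  assumes "e \<in> chains G X (n + 1)"
  shows "simp_boundary G X e \<in> rel_cycles G X Y n"
  using assms finite_vertices by (simp add: rel_cycles_def boundary_X_Suc boundary_boundary[OF assms] chains_one)

lemma boundaries_subgroup: "subgroup (quot_boundaries G X Y n) (quot_cycles G X Y n)"
proof -
  have sg: "subgroup (quot_boundaries G X Y n) (quot_chains G X Y n)"
    using group_hom.img_is_subgroup[OF quot_boundary_hom[of "n + 1"]] by (simp add: quot_boundaries_def)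
  have "quot_boundaries G X Y n \<subseteq> carrier (quot_cycles G X Y n)"
    by (auto simp: boundaries_eq cycles_carrier boundary_rel_cycle)
  then show ?thesis
    using Q.subgroup_incl[OF sg cycles_subgroup] by (simp add: quot_cycles_def)
qed

sublocale B: normal "quot_boundaries G X Y n" "quot_cycles G X Y n" for n
  using Z.subgroup_imp_normal[OF boundaries_subgroup] .

lemma homology_comm_group: "comm_group (quot_homology G X Y n)"
  unfolding quot_homology_def using Z.abelian_FactGroup[OF boundaries_subgroup] .

lemma homology_carrier: "carrier (quot_homology G X Y n) = hclass G X Y n ` rel_cycles G X Y n"
  by (simp add: quot_homology_def carrier_FactGroup cycles_carrier hclass_def image_image)

lemma hclass_mult:
  assumes "c \<in> rel_cycles G X Y n" "d \<in> rel_cycles G X Y n"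
  shows "hclass G X Y n c \<otimes>\<^bsub>quot_homology G X Y n\<^esub> hclass G X Y n d = hclass G X Y n (\<lambda>vs. c vs \<otimes> d vs)"
proof -
  have "cs n c \<otimes>\<^bsub>quot_cycles G X Y n\<^esub> cs n d = cs n (\<lambda>vs. c vs \<otimes> d vs)"
    using assms by (simp add: cycles_mult cs_mult rel_cycles_def)
  then show ?thesis
    using B.rcos_sum[of "cs n c" n "cs n d"] assms by (simp add: quot_homology_def hclass_def cycles_carrier)
qed

lemma hclass_cong:
  assumes "c \<in> chains G X n" "m \<in> chains G Y n"
  shows "hclass G X Y n (\<lambda>vs. m vs \<otimes> c vs) = hclass G X Y n c"
  using cs_eqI[OF assms] by (simp add: hclass_def)

text \<open>Peels off both layers of cosets, so that the kernels of the restrictions can be computed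
  among chains.\<close>

lemma hclass_one_iff:
  assumes c: "c \<in> rel_cycles G X Y n"
  shows "hclass G X Y n c = \<one>\<^bsub>quot_homology G X Y n\<^esub> \<longleftrightarrow>
    (\<exists>e\<in>chains G X (n + 1). (\<lambda>vs. c vs \<otimes> inv simp_boundary G X e vs) \<in> chains G Y n)"
proof -
  have cX: "c \<in> chains G X n" using c by (simp add: rel_cycles_def)
  have "hclass G X Y n c = \<one>\<^bsub>quot_homology G X Y n\<^esub> \<longleftrightarrow> cs n c \<in> quot_boundaries G X Y n"
    unfolding hclass_def quot_homology_def one_FactGroup
    using Z.coset_join1[OF _ _ boundaries_subgroup] Z.coset_join2[OF _ boundaries_subgroup] c
    by (metis cycles_carrier imageI)
  also have "\<dots> \<longleftrightarrow> (\<exists>e\<in>chains G X (n + 1). cs n c = cs n (simp_boundary G X e))"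
    by (auto simp: boundaries_eq)
  also have "\<dots> \<longleftrightarrow> (\<exists>e\<in>chains G X (n + 1). (\<lambda>vs. c vs \<otimes> inv simp_boundary G X e vs) \<in> chains G Y n)"
  proof (rule bex_cong[OF refl])
    fix e assume "e \<in> chains G X (n + 1)"
    then have b: "simp_boundary G X e \<in> chains G X n" by (rule boundary_X_Suc)
    let ?d = "\<lambda>vs. c vs \<otimes> inv simp_boundary G X e vs"
    have d: "?d \<in> chains G X n" using chains_mult[OF cX chains_inv[OF b]] .
    have "cs n c = cs n (\<lambda>vs. ?d vs \<otimes> simp_boundary G X e vs)"
      using chains_closed[OF cX] chains_closed[OF b] by (simp add: m_assoc)
    also have "\<dots> = cs n ?d \<otimes>\<^bsub>quot_chains G X Y n\<^esub> cs n (simp_boundary G X e)"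
      using cs_mult[OF d b] by simp
    finally have "cs n c = cs n (simp_boundary G X e) \<longleftrightarrow> cs n ?d = \<one>\<^bsub>quot_chains G X Y n\<^esub>"
      using Q.l_cancel_one[OF cs_closed[OF b] cs_closed[OF d]] Q.r_cancel_one[OF cs_closed[OF b] cs_closed[OF d]] by simp
    then show "cs n c = cs n (simp_boundary G X e) \<longleftrightarrow> ?d \<in> chains G Y n"
      using cs_one_iff[OF d] by (simp add: quot_one)
  qed
  finally show ?thesis .
qed

end

text \<open>The hypotheses range over all degrees, since a class in degree \<open>n\<close> involves
  boundaries coming from degree \<open>n + 1\<close> and a vanishing condition in degree
  \<open>n - 1\<close>. Independence of the representative has two layers: change by a chain of
  \<open>Y\<close>, then change by a boundary.\<close>

lemma quot_homology_map_hclass: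
  assumes P: "complex_pair G X Y" and P': "complex_pair G' X' Y'"
    and fX: "\<And>n c. c \<in> chains G X n \<Longrightarrow> f c \<in> chains G' X' n"
    and fY: "\<And>n c. c \<in> chains G Y n \<Longrightarrow> f c \<in> chains G' Y' n"
    and mult: "\<And>n c d. c \<in> chains G X n \<Longrightarrow> d \<in> chains G X n \<Longrightarrow>
        f (\<lambda>vs. c vs \<otimes>\<^bsub>G\<^esub> d vs) = (\<lambda>vs. f c vs \<otimes>\<^bsub>G'\<^esub> f d vs)"
    and bd: "\<And>n c. c \<in> chains G X n \<Longrightarrow> f (simp_boundary G X c) = simp_boundary G' X' (f c)"
    and c: "c \<in> rel_cycles G X Y n"
  shows "quot_homology_map G' X' Y' n f (hclass G X Y n c) = hclass G' X' Y' n (f c)"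
proof -
  interpret P: complex_pair G X Y by fact
  interpret P': complex_pair G' X' Y' by fact
  have cX: "c \<in> chains G X n" using c by (simp add: rel_cycles_def)
  have fc: "f c \<in> rel_cycles G' X' Y' n"
    using c fX fY bd[of c n] by (auto simp: rel_cycles_def) (metis fY)
  have qm: "quot_map G' X' Y' n f (P.cs n d) = P'.cs n (f d)" if d: "d \<in> chains G X n" for d
    unfolding quot_map_def
  proof (rule coset_map_r_coset)
    show "chains G Y n \<noteq> {}" using P.chains_one by blast
    fix m assume m: "m \<in> chains G Y n"
    then have "m \<in> chains G X n" using P.chains_mono P.sub by blast
    then show "P'.cs n (f (m \<otimes>\<^bsub>simp_chains G X n\<^esub> d)) = P'.cs n (f d)"
      using d fY[OF m] fX[OF d] by (simp add: P.chains_mult_eq mult P'.cs_eqI)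
  qed
  show "quot_homology_map G' X' Y' n f (hclass G X Y n c) = hclass G' X' Y' n (f c)"
    unfolding quot_homology_map_def hclass_def
  proof (rule coset_map_r_coset)
    show "quot_boundaries G X Y n \<noteq> {}"
      using subgroup.one_closed[OF P.boundaries_subgroup] by blast
    fix m assume "m \<in> quot_boundaries G X Y n"
    then obtain e where e: "e \<in> chains G X (n + 1)" and m: "m = P.cs n (simp_boundary G X e)"
      by (auto simp: P.boundaries_eq)
    let ?b = "simp_boundary G' X' (f e)"
    have b: "?b \<in> chains G' X' n" using P'.boundary_X_Suc[OF fX[OF e]] .
    have bc: "P'.cs n ?b \<in> carrier (quot_cycles G' X' Y' n)" "P'.cs n (f c) \<in> carrier (quot_cycles G' X' Y' n)"
      using P'.boundary_rel_cycle[OF fX[OF e]] fc by (simp_all add: P'.cycles_carrier)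
    have bB: "P'.cs n ?b \<in> quot_boundaries G' X' Y' n"
      using fX[OF e] by (auto simp: P'.boundaries_eq)
    have "m \<otimes>\<^bsub>quot_cycles G X Y n\<^esub> P.cs n c = P.cs n (\<lambda>vs. simp_boundary G X e vs \<otimes>\<^bsub>G\<^esub> c vs)"
      using P.boundary_X_Suc[OF e] cX by (simp add: m P.cycles_mult P.cs_mult)
    then have "quot_map G' X' Y' n f (m \<otimes>\<^bsub>quot_cycles G X Y n\<^esub> P.cs n c)
        = P'.cs n ?b \<otimes>\<^bsub>quot_cycles G' X' Y' n\<^esub> P'.cs n (f c)"
      using P.boundary_X_Suc[OF e] cX bd[OF e] b fX[OF cX]
      by (simp add: qm P.chains_mult mult P'.cycles_mult P'.cs_mult)
    then show "quot_boundaries G' X' Y' n #>\<^bsub>quot_cycles G' X' Y' n\<^esub>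
        quot_map G' X' Y' n f (m \<otimes>\<^bsub>quot_cycles G X Y n\<^esub> P.cs n c)
        = quot_boundaries G' X' Y' n #>\<^bsub>quot_cycles G' X' Y' n\<^esub> P'.cs n (f c)"
      using P'.Z.coset_mult_assoc[OF subgroup.subset[OF P'.boundaries_subgroup] bc]
        P'.Z.coset_join2[OF bc(1) P'.boundaries_subgroup bB]
      by simp
  qed
qed

section \<open>Chain maps of injective vertex maps\<close>

context comm_group
begin

lemma push_off:
  assumes "\<not> set ws \<subseteq> \<phi> ` \<Union>X"
  shows "simp_push G X \<phi> c ws = \<one>"
proof -
  have "set ws \<subseteq> \<phi> ` \<Union>X" if "set vs \<subseteq> \<Union>X" "map \<phi> vs = ws" for vs
    using that by (metis image_mono set_map)
  then have none: "{vs. set vs \<subseteq> \<Union>X \<and> map \<phi> vs = ws} = {}"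
    using assms by blast
  show ?thesis unfolding simp_push_def none by simp
qed

text \<open>On a distinct list injectivity leaves a single factor in the product of
  \<open>simp_push\<close>. Together with \<open>push_off\<close> this allows pushed chains to be
  computed value by value.\<close>

lemma push_map:
  assumes "inj_on \<phi> (\<Union>X)" "set vs \<subseteq> \<Union>X" "c \<in> chains G P n"
  shows "simp_push G X \<phi> c (map \<phi> vs) = c vs"
proof (cases "distinct vs")
  case True
  have "{us. set us \<subseteq> \<Union>X \<and> map \<phi> us = map \<phi> vs} = {vs}"
    using assms(1,2) by (auto simp: inj_on_map_eq_map inj_on_subset dest!: map_inj_on[rotated] intro: inj_on_subset)
  moreover have "distinct (map \<phi> vs)"
    using True assms(1,2) by (auto simp: distinct_map intro: inj_on_subset)
  ultimately show ?thesis
    using chains_closed[OF assms(3)] by (simp add: simp_push_def)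
next
  case False
  then have "\<not> distinct (map \<phi> vs)" "c vs = \<one>"
    using chains_distinct[OF assms(3), of vs] by (auto simp: distinct_map)
  then show ?thesis by (simp add: simp_push_def)
qed

lemma set_map_preimage:
  assumes "set ws \<subseteq> \<phi> ` V"
  obtains vs where "set vs \<subseteq> V" "ws = map \<phi> vs"
  using assms by (metis image_iff in_lists_conv_set lists_image subset_code(1))

lemma push_closed:
  assumes "c \<in> chains G P n"
  shows "simp_push G X \<phi> c ws \<in> carrier G"
  using chains_closed[OF assms] by (auto simp: simp_push_def intro!: finprod_closed)

lemma push_chains:
  assumes inj: "inj_on \<phi> (\<Union>X)" and c: "c \<in> chains G P n" and P: "\<And>F. F \<in> P \<Longrightarrow> \<phi> ` F \<in> P'"
  shows "simp_push G X \<phi> c \<in> chains G P' n"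
proof (rule chainsI)
  show "simp_push G X \<phi> c vs \<in> carrier G" for vs
    by (rule push_closed[OF c])
next
  fix ws assume ws: "simp_push G X \<phi> c ws \<noteq> \<one>"
  then show "distinct ws" by (auto simp: simp_push_def split: if_splits)
  from ws have "set ws \<subseteq> \<phi> ` \<Union>X" using push_off[of ws \<phi> X c] by blast
  then obtain vs where vs: "set vs \<subseteq> \<Union>X" "ws = map \<phi> vs"
    by (rule set_map_preimage)
  then have "c vs \<noteq> \<one>" using ws push_map[OF inj vs(1) c] by simp
  then show "set ws \<in> P'" "int (length ws) = n + 1"
    using chains_face[OF c, of vs] chains_length[OF c, of vs] P vs(2) by simp_all
next
  fix xs a b ys
  show "simp_push G X \<phi> c (xs @ a # b # ys) = inv simp_push G X \<phi> c (xs @ b # a # ys)"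
  proof (cases "set (xs @ a # b # ys) \<subseteq> \<phi> ` \<Union>X")
    case False
    then have "\<not> set (xs @ b # a # ys) \<subseteq> \<phi> ` \<Union>X" by auto
    then show ?thesis using push_off[OF False, of c] push_off[of "xs @ b # a # ys" \<phi> X c] by (metis inv_one)
  next
    case True
    then obtain vs where vs: "set vs \<subseteq> \<Union>X" "xs @ a # b # ys = map \<phi> vs"
      by (rule set_map_preimage)
    then obtain xs' a' b' ys' where *: "vs = xs' @ a' # b' # ys'" "xs = map \<phi> xs'" "a = \<phi> a'" "b = \<phi> b'" "ys = map \<phi> ys'"
      by (auto simp: append_eq_map_conv Cons_eq_map_conv)
    have "set (xs' @ b' # a' # ys') \<subseteq> \<Union>X" using vs(1) by (auto simp: *(1))
    then have "simp_push G X \<phi> c (xs @ b # a # ys) = c (xs' @ b' # a' # ys')"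
      using push_map[OF inj _ c, of "xs' @ b' # a' # ys'"] * by simp
    moreover have "simp_push G X \<phi> c (xs @ a # b # ys) = c (xs' @ a' # b' # ys')"
      using push_map[OF inj vs(1) c] vs(2) *(1) by simp
    ultimately show ?thesis
      using chains_swap[OF c, of xs' a' b' ys'] by simp
  qed
qed

lemma push_mult:
  assumes "c \<in> chains G P n" "d \<in> chains G P' n"
  shows "simp_push G X \<phi> (\<lambda>vs. c vs \<otimes> d vs) = (\<lambda>ws. simp_push G X \<phi> c ws \<otimes> simp_push G X \<phi> d ws)"
  using chains_closed[OF assms(1)] chains_closed[OF assms(2)] by (auto simp: simp_push_def finprod_multf)

lemma push_boundary:
  assumes inj: "inj_on \<phi> (\<Union>X)" and c: "c \<in> chains G X n"
    and down: "\<And>F F'. F \<in> X \<Longrightarrow> F' \<subseteq> F \<Longrightarrow> F' \<in> X"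
    and fin: "finite (\<Union>X')" and sub: "\<phi> ` \<Union>X \<subseteq> \<Union>X'"
  shows "simp_push G X \<phi> (simp_boundary G X c) = simp_boundary G X' (simp_push G X \<phi> c)"
proof
  fix ws
  have bc: "simp_boundary G X c \<in> chains G X (n - 1)"
    by (rule boundary_chains[OF c]) (use down in blast)
  show "simp_push G X \<phi> (simp_boundary G X c) ws = simp_boundary G X' (simp_push G X \<phi> c) ws"
  proof (cases "set ws \<subseteq> \<phi> ` \<Union>X")
    case False
    then have "simp_push G X \<phi> c (w # ws) = \<one>" for w
      by (intro push_off) auto
    then show ?thesis
      using push_off[OF False] by (simp add: simp_boundary_def)
  next
    case True
    then obtain vs where vs: "set vs \<subseteq> \<Union>X" "ws = map \<phi> vs"
      by (rule set_map_preimage)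
    \<comment> \<open>Vertices of \<open>X'\<close> outside the image contribute neutral factors;
      the remaining ones are reindexed along \<open>\<phi>\<close>.\<close>
    have "simp_boundary G X' (simp_push G X \<phi> c) ws = (\<Otimes>w\<in>\<phi> ` \<Union>X. simp_push G X \<phi> c (w # ws))"
      unfolding simp_boundary_def using fin sub push_closed[OF c]
      by (intro finprod_mono_neutral_cong_right) (auto intro!: push_off)
    also have "\<dots> = (\<Otimes>v\<in>\<Union>X. simp_push G X \<phi> c (\<phi> v # ws))"
      using inj push_closed[OF c] by (subst finprod_reindex) auto
    also have "\<dots> = (\<Otimes>v\<in>\<Union>X. c (v # vs))"
    proof (rule finprod_cong')
      show "simp_push G X \<phi> c (\<phi> v # ws) = c (v # vs)" if "v \<in> \<Union>X" for v
        using push_map[OF inj _ c, of "v # vs"] that vs by auto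
    qed (use chains_closed[OF c] in auto)
    also have "\<dots> = simp_push G X \<phi> (simp_boundary G X c) ws"
      using push_map[OF inj vs(1) bc] vs(2) by (simp add: simp_boundary_def)
    finally show ?thesis by simp
  qed
qed

end

section \<open>Excision\<close>

text \<open>Precomposition discards every face with a vertex outside the range of
  \<open>\<iota>\<close>, which in general destroys compatibility with the boundary;
  \<open>restr_boundary\<close> measures the defect.\<close>

definition restr :: "('v \<Rightarrow> 'u) \<Rightarrow> ('u list \<Rightarrow> 'g) \<Rightarrow> 'v list \<Rightarrow> 'g" where
  "restr \<iota> z = (\<lambda>vs. z (map \<iota> vs))"

lemma restr_apply: "restr \<iota> z vs = z (map \<iota> vs)"
  by (simp add: restr_def)

text \<open>By \<open>sep\<close>, a vertex discarded before pushing does not land among those kept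
  afterwards, so both orders discard the same faces.\<close>

lemma (in comm_group) restr_push:
  assumes z: "z \<in> chains G P n"
    and inj: "inj_on \<theta> (\<Union>Z)" "inj_on \<phi> (\<Union>X)" "inj \<iota>'"
    and comm: "\<And>v. \<theta> (\<iota> v) = \<iota>' (\<phi> v)"
    and sub: "\<iota> ` \<Union>X \<subseteq> \<Union>Z" and res: "restr \<iota> z \<in> chains G P' n"
    and sep: "\<And>u. u \<in> \<Union>Z \<Longrightarrow> \<theta> u \<in> range \<iota>' \<Longrightarrow> u \<in> \<iota> ` \<Union>X"
  shows "restr \<iota>' (simp_push G Z \<theta> z) = simp_push G X \<phi> (restr \<iota> z)"
proof
  fix ws
  show "restr \<iota>' (simp_push G Z \<theta> z) ws = simp_push G X \<phi> (restr \<iota> z) ws"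
  proof (cases "set ws \<subseteq> \<phi> ` \<Union>X")
    case True
    then obtain vs where vs: "set vs \<subseteq> \<Union>X" "ws = map \<phi> vs"
      by (rule set_map_preimage)
    have "set (map \<iota> vs) \<subseteq> \<Union>Z" using vs(1) sub by (metis image_mono order_trans set_map)
    then have "simp_push G Z \<theta> z (map \<theta> (map \<iota> vs)) = restr \<iota> z vs"
      using push_map[OF inj(1) _ z, of "map \<iota> vs"] by (simp add: restr_def)
    moreover have "map \<theta> (map \<iota> vs) = map \<iota>' ws"
      using comm by (simp add: vs(2))
    moreover have "simp_push G X \<phi> (restr \<iota> z) ws = restr \<iota> z vs"
      using push_map[OF inj(2) vs(1) res] vs(2) by simp
    ultimately show ?thesis
      by (simp only: restr_apply)
  next
    case False
    have "\<not> set (map \<iota>' ws) \<subseteq> \<theta> ` \<Union>Z"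
    proof
      assume *: "set (map \<iota>' ws) \<subseteq> \<theta> ` \<Union>Z"
      have "w \<in> \<phi> ` \<Union>X" if "w \<in> set ws" for w
      proof -
        have "\<iota>' w \<in> \<theta> ` \<Union>Z"
          using subsetD[OF *, of "\<iota>' w"] that by simp
        then obtain u where u: "u \<in> \<Union>Z" "\<iota>' w = \<theta> u" by (rule imageE)
        then have "u \<in> \<iota> ` \<Union>X" using sep[of u] by (metis rangeI)
        then obtain v where v: "u = \<iota> v" "v \<in> \<Union>X" by (rule imageE)
        then have "w = \<phi> v" using u(2) comm[of v] inj(3) by (simp add: inj_eq)
        then show ?thesis using v(2) by (rule image_eqI)
      qed
      then show False using False by blast
    qed
    then show ?thesis
      using push_off[OF False] by (simp add: restr_def push_off)
  qed
qed

text \<open>Cycles, not homology classes, of \<open>Z\<close> serve as common source of the two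
  restrictions: passing to the quotient by boundaries is left to the comparison of kernels.\<close>

abbreviation cycle_group ::
  "('g, 'm) monoid_scheme \<Rightarrow> 'u set set \<Rightarrow> int \<Rightarrow> ('u list \<Rightarrow> 'g) monoid" where
  "cycle_group G Z n \<equiv> simp_chains G Z n
     \<lparr>carrier := {z \<in> chains G Z n. simp_boundary G Z z = (\<lambda>_. \<one>\<^bsub>G\<^esub>)}\<rparr>"

text \<open>
  \<open>Z\<close> contains the full simplex on \<open>V\<close> (embedded by \<open>\<iota>\<close>), and the faces of \<open>Z\<close> outside of it
  lie over faces of \<open>X\<close>; by \<open>apex\<close>, the part of \<open>Z\<close> over each face of \<open>X\<close> is a cone.
\<close>

locale excision = comm_group G for G (structure) +
  fixes \<iota> :: "'v \<Rightarrow> 'u" and V :: "'v set" and Z :: "'u set set" and X :: "'v set set"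
  assumes inj: "inj \<iota>"
    and finite_Z: "finite (\<Union>Z)"
    and down_Z: "F \<in> Z \<Longrightarrow> F' \<subseteq> F \<Longrightarrow> F' \<in> Z"
    and full: "\<sigma> \<subseteq> V \<Longrightarrow> \<iota> ` \<sigma> \<in> Z"
    and trace: "F \<in> Z \<Longrightarrow> \<iota> -` F \<subseteq> V"
    and X_sub: "X \<subseteq> Pow V"
    and down_X: "\<sigma> \<in> X \<Longrightarrow> \<tau> \<subseteq> \<sigma> \<Longrightarrow> \<tau> \<in> X"
    and mixed: "F \<in> Z \<Longrightarrow> \<not> F \<subseteq> range \<iota> \<Longrightarrow> \<iota> -` F \<in> X"
    and apex: "\<sigma> \<in> X \<Longrightarrow> \<exists>w\<in>\<Union>Z - range \<iota>. \<forall>F\<in>Z. \<iota> -` F = \<sigma> \<longrightarrow> insert w F \<in> Z"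
begin

lemma V_sub: "\<iota> ` V \<subseteq> \<Union>Z"
  using full[of V] by blast

lemma finite_V: "finite V"
  using finite_imageD[OF finite_subset[OF V_sub finite_Z] inj_on_subset[OF inj]] by simp

lemma vertices_Z: "u \<in> \<Union>Z \<Longrightarrow> u \<in> range \<iota> \<Longrightarrow> u \<in> \<iota> ` V"
  using trace by blast

sublocale pair: complex_pair G "Pow V" X
  using finite_V X_sub down_X by unfold_locales auto

lemma boundary_Z: "z \<in> chains G Z n \<Longrightarrow> simp_boundary G Z z \<in> chains G Z (n - 1)"
  by (rule boundary_chains) (use down_Z in blast)+

text \<open>All faces of \<open>Z\<close> lying over \<open>X\<close>: by \<open>mixed\<close>, those not contained in \<open>range \<iota>\<close> do.\<close>

definition D :: "'u set set" where
  "D = {F \<in> Z. F \<subseteq> range \<iota> \<longrightarrow> \<iota> -` F \<in> X}"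

lemma D_down: "F \<in> D \<Longrightarrow> F' \<subseteq> F \<Longrightarrow> F' \<in> D"
proof -
  assume F: "F \<in> D" "F' \<subseteq> F"
  then have "\<iota> -` F \<in> X" using mixed by (auto simp: D_def)
  moreover have "\<iota> -` F' \<subseteq> \<iota> -` F" using F by auto
  ultimately show ?thesis using F down_Z[of F F'] down_X by (auto simp: D_def)
qed

lemma D_acyclic:
  assumes z: "z \<in> chains G D n" "simp_boundary G Z z = (\<lambda>_. \<one>)"
  shows "\<exists>y\<in>chains G D (n + 1). simp_boundary G Z y = z"
\<comment> \<open>With \<open>T = range \<iota>\<close>, faces with equal trace are those with equal
  preimage under \<open>\<iota>\<close>, for which \<open>apex\<close> provides a cone
  point.\<close>
proof (rule acyclic[OF finite_Z _ _ _ z, where T = "range \<iota>"])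
  show "\<Union>D \<subseteq> \<Union>Z" by (auto simp: D_def)
  show "\<exists>w\<in>\<Union>Z - range \<iota>. \<forall>F\<in>D. F \<inter> range \<iota> = \<sigma> \<longrightarrow> insert w F \<in> D" if \<sigma>: "\<sigma> \<in> D" "\<sigma> \<subseteq> range \<iota>" for \<sigma>
  proof -
    have "\<iota> -` \<sigma> \<in> X" using \<sigma> by (auto simp: D_def)
    from apex[OF this] obtain w where w: "w \<in> \<Union>Z - range \<iota>" "\<forall>F\<in>Z. \<iota> -` F = \<iota> -` \<sigma> \<longrightarrow> insert w F \<in> Z"
      by (rule bexE)
    have "insert w F \<in> D" if F: "F \<in> D" "F \<inter> range \<iota> = \<sigma>" for F
    proof -
      have "\<iota> -` F = \<iota> -` \<sigma>" "F \<in> Z" using F by (auto simp: D_def)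
      then have "insert w F \<in> Z" using w(2) by simp
      \<comment> \<open>The enlarged face has the vertex \<open>w\<close> outside
        \<open>range \<iota>\<close>, so the condition in \<open>D\<close> on pure faces is vacuous
        for it.\<close>
      then show ?thesis using w(1) by (simp add: D_def)
    qed
    with w(1) show ?thesis by (intro bexI[of _ w]) simp_all
  qed
qed (use D_down in blast)

lemma restr_chains:
  assumes z: "z \<in> chains G P n" and P: "\<And>\<sigma>. \<iota> ` \<sigma> \<in> P \<Longrightarrow> \<sigma> \<in> P'"
  shows "restr \<iota> z \<in> chains G P' n"
proof (rule chainsI)
  fix vs assume "restr \<iota> z vs \<noteq> \<one>"
  then have *: "z (map \<iota> vs) \<noteq> \<one>" by (simp add: restr_def)
  show "distinct vs" using chains_distinct[OF z *] by (simp add: distinct_map)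
  show "set vs \<in> P'" using chains_face[OF z *] P by simp
  show "int (length vs) = n + 1" using chains_length[OF z *] by simp
next
  show "restr \<iota> z (xs @ a # b # ys) = inv restr \<iota> z (xs @ b # a # ys)" for xs a b ys
    using chains_swap[OF z, of "map \<iota> xs" "\<iota> a" "\<iota> b" "map \<iota> ys"] by (simp add: restr_def)
qed (simp add: restr_def chains_closed[OF z])

lemma restr_Z: "z \<in> chains G Z n \<Longrightarrow> restr \<iota> z \<in> chains G (Pow V) n"
  by (erule restr_chains) (use trace inj in \<open>force simp: inj_vimage_image_eq\<close>)

lemma restr_D: "z \<in> chains G D n \<Longrightarrow> restr \<iota> z \<in> chains G X n"
  by (erule restr_chains) (use inj in \<open>auto simp: D_def inj_vimage_image_eq\<close>)

text \<open>Restricting before taking the boundary loses exactly the terms in which a vertex outside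
  the image of \<open>V\<close> is deleted. The faces concerned are mixed, so by
  \<open>mixed\<close> the facets left over lie in \<open>X\<close>: restriction is a chain map
  modulo \<open>X\<close>.\<close>

lemma restr_boundary:
  assumes z: "z \<in> chains G Z n"
  shows "(\<lambda>vs. restr \<iota> (simp_boundary G Z z) vs \<otimes> inv simp_boundary G (Pow V) (restr \<iota> z) vs) \<in> chains G X (n - 1)"
    (is "?d \<in> _")
proof -
  note rz = restr_Z[OF z]
  have d: "?d \<in> chains G (Pow V) (n - 1)"
    using chains_mult[OF restr_Z[OF boundary_Z[OF z]] chains_inv[OF pair.boundary_X[OF rz]]] .
  have rest: "?d ws = (\<Otimes>u\<in>\<Union>Z - \<iota> ` V. z (u # map \<iota> ws))" for ws
  proof -
    have cl: "z us \<in> carrier G" for us by (rule chains_closed[OF z])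
    have "\<Union>Z = \<iota> ` V \<union> (\<Union>Z - \<iota> ` V)" using V_sub by blast
    then have "simp_boundary G Z z (map \<iota> ws) = (\<Otimes>u\<in>\<iota> ` V \<union> (\<Union>Z - \<iota> ` V). z (u # map \<iota> ws))"
      by (simp add: simp_boundary_def)
    also have "\<dots> = (\<Otimes>u\<in>\<iota> ` V. z (u # map \<iota> ws)) \<otimes> (\<Otimes>u\<in>\<Union>Z - \<iota> ` V. z (u # map \<iota> ws))"
      using finite_V finite_Z cl by (subst finprod_Un_disjoint) auto
    also have "(\<Otimes>u\<in>\<iota> ` V. z (u # map \<iota> ws)) = simp_boundary G (Pow V) (restr \<iota> z) ws"
      using inj_on_subset[OF inj] cl by (subst finprod_reindex) (auto simp: simp_boundary_def restr_def)
    finally have split: "restr \<iota> (simp_boundary G Z z) ws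
        = simp_boundary G (Pow V) (restr \<iota> z) ws \<otimes> (\<Otimes>u\<in>\<Union>Z - \<iota> ` V. z (u # map \<iota> ws))"
      by (simp only: restr_apply)
    have "p \<otimes> r \<otimes> inv p = r" if "p \<in> carrier G" "r \<in> carrier G" for p r
      using that by (simp add: m_comm[of p r] m_assoc)
    then show ?thesis
      using boundary_closed[OF rz, of "Pow V" ws] cl unfolding split by simp
  qed
  have "set ws \<in> X" if "?d ws \<noteq> \<one>" for ws
  proof -
    have "\<exists>u\<in>\<Union>Z - \<iota> ` V. z (u # map \<iota> ws) \<noteq> \<one>"
      using rest[of ws] that finprod_one_eqI[of "\<Union>Z - \<iota> ` V" "\<lambda>u. z (u # map \<iota> ws)"] by auto
    then obtain u where u: "u \<in> \<Union>Z - \<iota> ` V" "z (u # map \<iota> ws) \<noteq> \<one>"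
      by (rule bexE)
    \<comment> \<open>A vertex of \<open>Z\<close> outside the image of \<open>V\<close> lies
      outside \<open>range \<iota>\<close>, which makes this face mixed.\<close>
    then have "insert u (\<iota> ` set ws) \<in> Z" "u \<notin> range \<iota>"
      using chains_face[OF z u(2)] vertices_Z by auto
    then have "\<iota> -` insert u (\<iota> ` set ws) \<in> X" by (intro mixed) auto
    moreover have "\<iota> -` insert u (\<iota> ` set ws) = set ws"
      using \<open>u \<notin> range \<iota>\<close> inj by (auto simp: inj_def)
    ultimately show ?thesis by simp
  qed
  then show ?thesis
    using chains_closed[OF d] chains_distinct[OF d] chains_length[OF d] chains_swap[OF d]
    by (intro chainsI) blast+
qed

text \<open>Extension by the neutral element. Unlike \<open>restr\<close> it is a chain map, but it
  turns a cycle modulo \<open>X\<close> only into a cycle modulo \<open>D\<close>, so lifting a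
  class also needs \<open>D_acyclic\<close>.\<close>

abbreviation ext :: "('v list \<Rightarrow> 'a) \<Rightarrow> 'u list \<Rightarrow> 'a" where
  "ext \<equiv> simp_push G (Pow V) \<iota>"

lemma inj_V: "inj_on \<iota> (\<Union>(Pow V))"
  by (rule inj_on_subset[OF inj]) simp

lemma ext_Z: "c \<in> chains G (Pow V) n \<Longrightarrow> ext c \<in> chains G Z n"
  by (rule push_chains[OF inj_V]) (auto intro: full)

lemma ext_D: "c \<in> chains G X n \<Longrightarrow> ext c \<in> chains G D n"
  by (rule push_chains[OF inj_V]) (use X_sub inj in \<open>auto simp: D_def inj_vimage_image_eq intro: full\<close>)

lemma ext_boundary: "c \<in> chains G (Pow V) n \<Longrightarrow> simp_boundary G Z (ext c) = ext (simp_boundary G (Pow V) c)"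
  by (rule push_boundary[OF inj_V, symmetric]) (use finite_Z V_sub in auto)

lemma restr_ext:
  assumes "c \<in> chains G (Pow V) n"
  shows "restr \<iota> (ext c) = c"
proof
  fix vs
  show "restr \<iota> (ext c) vs = c vs"
  proof (cases "set vs \<subseteq> V")
    case True
    then show ?thesis using push_map[OF inj_V _ assms] by (simp add: restr_def)
  next
    case False
    then have "\<not> set (map \<iota> vs) \<subseteq> \<iota> ` \<Union>(Pow V)"
      using inj by (simp add: inj_image_subset_iff)
    then have "ext c (map \<iota> vs) = \<one>" by (rule push_off)
    moreover have "c vs = \<one>"
      using False chains_face[OF assms, of vs] by auto
    ultimately show ?thesis by (simp add: restr_def)
  qed
qed

lemma restr_rel_cycle:
  assumes "z \<in> carrier (cycle_group G Z n)"
  shows "restr \<iota> z \<in> rel_cycles G (Pow V) X n"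
proof -
  have z: "z \<in> chains G Z n" and bz: "simp_boundary G Z z = (\<lambda>_. \<one>)"
    using assms by auto
  have "(\<lambda>vs. inv (restr \<iota> (simp_boundary G Z z) vs \<otimes> inv simp_boundary G (Pow V) (restr \<iota> z) vs)) \<in> chains G X (n - 1)"
    by (rule chains_inv[OF restr_boundary[OF z]])
  then show ?thesis
    using restr_Z[OF z] boundary_closed[OF restr_Z[OF z], of "Pow V"] bz
    by (simp add: rel_cycles_def restr_def)
qed

section \<open>From cycles of \<open>Z\<close> onto the homology of the pair\<close>

lemma cycles_group: "Group.group (cycle_group G Z n)"
proof -
  have "subgroup {z \<in> chains G Z n. simp_boundary G Z z = (\<lambda>_. \<one>)} (simp_chains G Z n)"
  proof (rule group.subgroupI)
    show "Group.group (simp_chains G Z n)"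
      by (rule comm_group.axioms(2)[OF chains_comm_group])
    have "simp_boundary G Z (\<lambda>_. \<one>) = (\<lambda>_. \<one>)"
      by (simp add: simp_boundary_def)
    then show "{z \<in> chains G Z n. simp_boundary G Z z = (\<lambda>_. \<one>)} \<noteq> {}"
      using chains_one by blast
  qed (auto simp: chains_inv_eq chains_inv boundary_inv chains_mult_eq chains_mult boundary_mult)
  then show ?thesis
    using group.subgroup_imp_group comm_group.axioms(2)[OF chains_comm_group] by blast
qed

lemma hclass_restr_hom:
  "group_hom (cycle_group G Z n) (quot_homology G (Pow V) X n) (\<lambda>z. hclass G (Pow V) X n (restr \<iota> z))"
proof -
  have "(\<lambda>z. hclass G (Pow V) X n (restr \<iota> z)) \<in> hom (cycle_group G Z n) (quot_homology G (Pow V) X n)"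
  proof (rule homI)
    fix z z' assume z: "z \<in> carrier (cycle_group G Z n)" and z': "z' \<in> carrier (cycle_group G Z n)"
    then show "hclass G (Pow V) X n (restr \<iota> z) \<in> carrier (quot_homology G (Pow V) X n)"
      unfolding pair.homology_carrier using restr_rel_cycle by blast
    show "hclass G (Pow V) X n (restr \<iota> (z \<otimes>\<^bsub>cycle_group G Z n\<^esub> z')) =
      hclass G (Pow V) X n (restr \<iota> z) \<otimes>\<^bsub>quot_homology G (Pow V) X n\<^esub> hclass G (Pow V) X n (restr \<iota> z')"
      using pair.hclass_mult[OF restr_rel_cycle[OF z] restr_rel_cycle[OF z']]
      by (simp add: chains_mult_eq restr_def)
  qed
  then show ?thesis
    using cycles_group comm_group.axioms(2)[OF pair.homology_comm_group]
    by (simp add: group_hom_def group_hom_axioms_def)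
qed

text \<open>The boundary of \<open>ext c\<close> is a cycle in \<open>D\<close> and hence the
  boundary of some \<open>u\<close> in \<open>D\<close>. Dividing \<open>ext c\<close> by
  \<open>u\<close> gives an absolute cycle, and since \<open>u\<close> restricts into
  \<open>X\<close>, the class is still that of \<open>c\<close>.\<close>

lemma hclass_restr_surj:
  "(\<lambda>z. hclass G (Pow V) X n (restr \<iota> z)) ` carrier (cycle_group G Z n) = carrier (quot_homology G (Pow V) X n)"
proof
  show "(\<lambda>z. hclass G (Pow V) X n (restr \<iota> z)) ` carrier (cycle_group G Z n) \<subseteq> carrier (quot_homology G (Pow V) X n)"
    unfolding pair.homology_carrier using restr_rel_cycle by blast
  have lift: "\<exists>z\<in>carrier (cycle_group G Z n). hclass G (Pow V) X n (restr \<iota> z) = hclass G (Pow V) X n c"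
    if "c \<in> rel_cycles G (Pow V) X n" for c
  proof -
    have c: "c \<in> chains G (Pow V) n" and bc: "simp_boundary G (Pow V) c \<in> chains G X (n - 1)"
      using that by (auto simp: rel_cycles_def)
    have b: "simp_boundary G Z (ext c) \<in> chains G D (n - 1)"
      using ext_D[OF bc] ext_boundary[OF c] by simp
    have "simp_boundary G Z (simp_boundary G Z (ext c)) = (\<lambda>_. \<one>)"
      by (rule boundary_boundary[OF ext_Z[OF c] finite_Z])
    then obtain u where u: "u \<in> chains G D n" "simp_boundary G Z u = simp_boundary G Z (ext c)"
      using D_acyclic[OF b] by auto
    have uZ: "u \<in> chains G Z n"
      using u(1) by (rule chains_mono) (auto simp: D_def)
    define z where "z = (\<lambda>vs. inv u vs \<otimes> ext c vs)"
    have "z \<in> chains G Z n"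
      unfolding z_def by (rule chains_mult[OF chains_inv[OF uZ] ext_Z[OF c]])
    moreover have "simp_boundary G Z z = (\<lambda>_. \<one>)"
      unfolding z_def boundary_mult[OF chains_inv[OF uZ] ext_Z[OF c]] boundary_inv[OF uZ] u(2)
      using boundary_closed[OF ext_Z[OF c]] by simp
    ultimately have "z \<in> carrier (cycle_group G Z n)" by simp
    moreover have "restr \<iota> z = (\<lambda>vs. inv restr \<iota> u vs \<otimes> c vs)"
      using fun_cong[OF restr_ext[OF c]] by (simp add: z_def restr_def)
    then have "hclass G (Pow V) X n (restr \<iota> z) = hclass G (Pow V) X n c"
      using pair.hclass_cong[OF c chains_inv[OF restr_D[OF u(1)]]] by simp
    ultimately show ?thesis by blast
  qed
  show "carrier (quot_homology G (Pow V) X n) \<subseteq> (\<lambda>z. hclass G (Pow V) X n (restr \<iota> z)) ` carrier (cycle_group G Z n)"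
  proof (rule subsetI)
    fix x assume "x \<in> carrier (quot_homology G (Pow V) X n)"
    then obtain c where "x = hclass G (Pow V) X n c" and c: "c \<in> rel_cycles G (Pow V) X n"
      unfolding pair.homology_carrier by (rule imageE)
    moreover from lift[OF c] obtain z where "z \<in> carrier (cycle_group G Z n)"
      "hclass G (Pow V) X n (restr \<iota> z) = hclass G (Pow V) X n c" by (rule bexE)
    ultimately show "x \<in> (\<lambda>z. hclass G (Pow V) X n (restr \<iota> z)) ` carrier (cycle_group G Z n)"
      by (intro image_eqI[of _ _ z]) simp_all
  qed
qed

text \<open>The right-hand side does not mention \<open>\<iota>\<close>, which is why the
  restrictions to the two sides have equal kernels. A filling in \<open>Z\<close> restricts to a
  filling modulo \<open>X\<close>. Conversely, dividing \<open>z\<close> by the boundary of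
  \<open>ext e\<close> leaves a cycle in \<open>D\<close>, which bounds there.\<close>

lemma hclass_restr_kernel:
  assumes "z \<in> carrier (cycle_group G Z n)"
  shows "hclass G (Pow V) X n (restr \<iota> z) = \<one>\<^bsub>quot_homology G (Pow V) X n\<^esub> \<longleftrightarrow>
    (\<exists>y\<in>chains G Z (n + 1). simp_boundary G Z y = z)"
proof -
  have z: "z \<in> chains G Z n" and bz: "simp_boundary G Z z = (\<lambda>_. \<one>)"
    using assms by auto
  have "(\<exists>e\<in>chains G (Pow V) (n + 1). (\<lambda>vs. restr \<iota> z vs \<otimes> inv simp_boundary G (Pow V) e vs) \<in> chains G X n) \<longleftrightarrow>
    (\<exists>y\<in>chains G Z (n + 1). simp_boundary G Z y = z)" (is "?L \<longleftrightarrow> ?R")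
  proof
    assume ?R
    then obtain y where y: "y \<in> chains G Z (n + 1)" "simp_boundary G Z y = z" by blast
    then show ?L
      using restr_boundary[OF y(1)] restr_Z[OF y(1)] by auto
  next
    assume ?L
    then obtain e where e: "e \<in> chains G (Pow V) (n + 1)"
      and X: "(\<lambda>vs. restr \<iota> z vs \<otimes> inv simp_boundary G (Pow V) e vs) \<in> chains G X n" by blast
    note ez = ext_Z[OF e]
    have be: "simp_boundary G Z (ext e) \<in> chains G Z n" using boundary_Z[OF ez] by simp
    define d where "d = (\<lambda>us. z us \<otimes> inv simp_boundary G Z (ext e) us)"
    have d: "d \<in> chains G Z n"
      unfolding d_def by (rule chains_mult[OF z chains_inv[OF be]])
    have rd: "restr \<iota> d = (\<lambda>vs. restr \<iota> z vs \<otimes> inv simp_boundary G (Pow V) e vs)"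
      using fun_cong[OF restr_ext[OF pair.boundary_X[OF e]]] ext_boundary[OF e]
      by (simp add: d_def restr_def)
    \<comment> \<open>Membership in \<open>D\<close> has to be checked only for faces inside
      \<open>range \<iota>\<close>; on these the values of \<open>d\<close> are those of its
      restriction, a chain of \<open>X\<close>.\<close>
    have "set us \<in> D" if us: "d us \<noteq> \<one>" for us
    proof -
      have "\<iota> -` set us \<in> X" if us_range: "set us \<subseteq> range \<iota>"
      proof -
        obtain vs where vs: "us = map \<iota> vs" by (rule set_map_preimage[OF us_range])
        then have "restr \<iota> d vs \<noteq> \<one>" using us by (simp add: restr_def)
        then have "set vs \<in> X" using chains_face[OF X, of vs] by (simp add: rd)
        then show ?thesis using inj by (simp add: vs inj_vimage_image_eq)
      qed
      then show ?thesis using chains_face[OF d us] by (simp add: D_def)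
    qed
    then have dD: "d \<in> chains G D n"
      using chains_closed[OF d] chains_distinct[OF d] chains_length[OF d] chains_swap[OF d]
      by (intro chainsI) blast+
    have "simp_boundary G Z d = (\<lambda>_. \<one>)"
      unfolding d_def boundary_mult[OF z chains_inv[OF be]] boundary_inv[OF be] bz boundary_boundary[OF ez finite_Z]
      by simp
    then obtain y where y: "y \<in> chains G D (n + 1)" "simp_boundary G Z y = d"
      using D_acyclic[OF dD] by blast
    have yZ: "y \<in> chains G Z (n + 1)"
      using y(1) by (rule chains_mono) (auto simp: D_def)
    have "simp_boundary G Z (\<lambda>us. y us \<otimes> ext e us) = z"
      unfolding boundary_mult[OF yZ ez] y(2) d_def
      using chains_closed[OF z] chains_closed[OF be] by (simp add: m_assoc)
    then show ?R using chains_mult[OF yZ ez] by blast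
  qed
  then show ?thesis
    by (simp only: pair.hclass_one_iff[OF restr_rel_cycle[OF assms]])
qed

end

section \<open>Naturality of the restriction\<close>

lemma quot_homology_map_push_restr:
  assumes E: "excision G \<iota> V Z X" and E': "excision G \<iota>' V' Z' X'"
    and \<phi>: "inj_on \<phi> V" "\<phi> ` V \<subseteq> V'" "\<And>\<sigma>. \<sigma> \<in> X \<Longrightarrow> \<phi> ` \<sigma> \<in> X'"
    and \<theta>: "inj_on \<theta> (\<Union>Z)" "\<theta> ` \<Union>Z \<subseteq> \<Union>Z'" "\<And>F. F \<in> Z \<Longrightarrow> \<theta> ` F \<in> Z'"
    and comm: "\<And>v. \<theta> (\<iota> v) = \<iota>' (\<phi> v)"
    and sep: "\<And>u. u \<in> \<Union>Z \<Longrightarrow> \<theta> u \<in> range \<iota>' \<Longrightarrow> u \<in> \<iota> ` V"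
    and z: "z \<in> carrier (cycle_group G Z n)"
  shows "quot_homology_map G (Pow V') X' n (simp_push G (Pow V) \<phi>) (hclass G (Pow V) X n (restr \<iota> z))
      = hclass G (Pow V') X' n (restr \<iota>' (simp_push G Z \<theta> z))"
proof -
  interpret E: excision G \<iota> V Z X by fact
  interpret E': excision G \<iota>' V' Z' X' by fact
  have zZ: "z \<in> chains G Z n" using z by simp
  have inj: "inj_on \<phi> (\<Union>(Pow V))" using \<phi>(1) by simp
  have restr_push: "restr \<iota>' (simp_push G Z \<theta> z) = simp_push G (Pow V) \<phi> (restr \<iota> z)"
    by (rule E.restr_push[OF zZ \<theta>(1) inj E'.inj comm _ E.restr_Z[OF zZ]]) (use E.V_sub sep in simp_all)
  show ?thesis
    unfolding restr_push
  proof (rule quot_homology_map_hclass[OF E.pair.complex_pair_axioms E'.pair.complex_pair_axioms _ _ _ _ E.restr_rel_cycle[OF z]])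
    fix m c assume c: "c \<in> chains G (Pow V) m"
    show "simp_push G (Pow V) \<phi> c \<in> chains G (Pow V') m"
      by (rule E.push_chains[OF inj c]) (use \<phi>(2) in blast)
    show "simp_push G (Pow V) \<phi> (simp_boundary G (Pow V) c) = simp_boundary G (Pow V') (simp_push G (Pow V) \<phi> c)"
      by (rule E.push_boundary[OF inj c]) (use \<phi>(2) E'.finite_V in auto)
    fix d assume d: "d \<in> chains G (Pow V) m"
    show "simp_push G (Pow V) \<phi> (\<lambda>vs. c vs \<otimes>\<^bsub>G\<^esub> d vs)
        = (\<lambda>vs. simp_push G (Pow V) \<phi> c vs \<otimes>\<^bsub>G\<^esub> simp_push G (Pow V) \<phi> d vs)"
      by (rule E.push_mult[OF c d])
  next
    fix m c assume "c \<in> chains G X m"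
    then show "simp_push G (Pow V) \<phi> c \<in> chains G X' m"
      by (rule E.push_chains[OF inj]) (rule \<phi>(3))
  qed
qed

lemma push_cycle:
  assumes G: "comm_group G" and \<theta>: "inj_on \<theta> (\<Union>Z)" "\<theta> ` \<Union>Z \<subseteq> \<Union>Z'" "\<And>F. F \<in> Z \<Longrightarrow> \<theta> ` F \<in> Z'"
    and down: "\<And>F F'. F \<in> Z \<Longrightarrow> F' \<subseteq> F \<Longrightarrow> F' \<in> Z" and fin: "finite (\<Union>Z')"
    and z: "z \<in> carrier (cycle_group G Z n)"
  shows "simp_push G Z \<theta> z \<in> carrier (cycle_group G Z' n)"
proof -
  interpret comm_group G by fact
  have zZ: "z \<in> chains G Z n" and bz: "simp_boundary G Z z = (\<lambda>_. \<one>\<^bsub>G\<^esub>)" using z by auto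
  have "simp_push G Z \<theta> z \<in> chains G Z' n"
    by (rule push_chains[OF \<theta>(1) zZ \<theta>(3)])
  moreover have "simp_boundary G Z' (simp_push G Z \<theta> z) = simp_push G Z \<theta> (simp_boundary G Z z)"
    by (rule push_boundary[OF \<theta>(1) zZ _ fin \<theta>(2), symmetric]) (rule down)
  moreover have "simp_push G Z \<theta> (\<lambda>_. \<one>\<^bsub>G\<^esub>) = (\<lambda>_. \<one>\<^bsub>G\<^esub>)"
    by (auto simp: simp_push_def fun_eq_iff intro!: finprod_one_eqI)
  ultimately show ?thesis using bz by simp
qed

section \<open>Change of coefficients\<close>

context
  fixes G :: "('g, 'm) monoid_scheme" and G' :: "('h, 'k) monoid_scheme" and h
  assumes G: "comm_group G" and G': "comm_group G'" and h: "h \<in> hom G G'"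
begin

interpretation G: comm_group G by (rule G)
interpretation G': comm_group G' by (rule G')
interpretation h: group_hom G G' h
  using h by (simp add: group_hom_def group_hom_axioms_def G.is_group G'.is_group)

lemma hom_chains:
  assumes "c \<in> chains G X n"
  shows "h \<circ> c \<in> chains G' X n"
proof (rule G'.chainsI)
  note cl = G.chains_closed[OF assms]
  show "(h \<circ> c) vs \<in> carrier G'" for vs using cl by simp
  show "(h \<circ> c) (xs @ a # b # ys) = inv\<^bsub>G'\<^esub> (h \<circ> c) (xs @ b # a # ys)" for xs a b ys
    using G.chains_swap[OF assms, of xs a b ys] cl by simp
  fix vs assume "(h \<circ> c) vs \<noteq> \<one>\<^bsub>G'\<^esub>"
  then have "c vs \<noteq> \<one>\<^bsub>G\<^esub>" by force
  then show "distinct vs" "set vs \<in> X" "int (length vs) = n + 1"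
    using G.chains_distinct[OF assms] G.chains_face[OF assms] G.chains_length[OF assms] by simp_all
qed

lemma hom_boundary:
  assumes "c \<in> chains G X n"
  shows "simp_boundary G' Y (h \<circ> c) = h \<circ> simp_boundary G Y c"
proof
  fix ws
  have "(\<Otimes>\<^bsub>G'\<^esub>v\<in>U. h (c (v # ws))) = h (\<Otimes>\<^bsub>G\<^esub>v\<in>U. c (v # ws))" for U
    by (induction U rule: infinite_finite_induct) (use G.chains_closed[OF assms] in \<open>simp_all add: Pi_def\<close>)
  then show "simp_boundary G' Y (h \<circ> c) ws = (h \<circ> simp_boundary G Y c) ws"
    by (simp add: simp_boundary_def)
qed

lemma hom_cycle:
  assumes "z \<in> carrier (cycle_group G Z n)"
  shows "h \<circ> z \<in> carrier (cycle_group G' Z n)"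
  using assms hom_chains[of z Z n] hom_boundary[of z Z n Z] by (auto simp: fun_eq_iff)

lemma quot_homology_map_hom_restr:
  assumes E: "excision G \<iota> V Z X" and E': "excision G' \<iota> V Z X"
    and z: "z \<in> carrier (cycle_group G Z n)"
  shows "quot_homology_map G' (Pow V) X n (\<lambda>c. h \<circ> c) (hclass G (Pow V) X n (restr \<iota> z))
      = hclass G' (Pow V) X n (restr \<iota> (h \<circ> z))"
proof -
  interpret E: excision G \<iota> V Z X by fact
  interpret E': excision G' \<iota> V Z X by fact
  have "restr \<iota> (h \<circ> z) = h \<circ> restr \<iota> z"
    by (simp add: restr_def comp_def)
  moreover have "quot_homology_map G' (Pow V) X n (\<lambda>c. h \<circ> c) (hclass G (Pow V) X n (restr \<iota> z))
      = hclass G' (Pow V) X n (h \<circ> restr \<iota> z)"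
  proof (rule quot_homology_map_hclass[OF E.pair.complex_pair_axioms E'.pair.complex_pair_axioms _ _ _ _ E.restr_rel_cycle[OF z]])
    fix m c d assume c: "c \<in> chains G (Pow V) m" and d: "d \<in> chains G (Pow V) m"
    show "h \<circ> (\<lambda>vs. c vs \<otimes>\<^bsub>G\<^esub> d vs) = (\<lambda>vs. (h \<circ> c) vs \<otimes>\<^bsub>G'\<^esub> (h \<circ> d) vs)"
      using G.chains_closed[OF c] G.chains_closed[OF d] by (simp add: fun_eq_iff)
  qed (simp_all only: hom_chains hom_boundary)
  ultimately show ?thesis by simp
qed

end

section \<open>Dowker complexes of a relation\<close>

text \<open>The complex \<open>Z\<close>, with its two kinds of vertices kept apart by the sum type.
  If one side of a face is empty the condition is vacuous, so the full simplices on \<open>V\<close>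
  and on \<open>W\<close> are subcomplexes.\<close>

definition biclique_complex :: "'v set \<Rightarrow> 'w set \<Rightarrow> ('v \<Rightarrow> 'w \<Rightarrow> bool) \<Rightarrow> ('v + 'w) set set" where
  "biclique_complex V W R = {F. F \<subseteq> V <+> W \<and> (\<forall>v w. Inl v \<in> F \<longrightarrow> Inr w \<in> F \<longrightarrow> R v w)}"

text \<open>For empty \<open>W\<close> not even the empty face belongs to it. This agrees with M(A)
  when A has at most one point, where the empty graph is connected.\<close>

definition dowker_complex :: "'v set \<Rightarrow> 'w set \<Rightarrow> ('v \<Rightarrow> 'w \<Rightarrow> bool) \<Rightarrow> 'v set set" where
  "dowker_complex V W R = {\<sigma>. \<sigma> \<subseteq> V \<and> (\<exists>w\<in>W. \<forall>v\<in>\<sigma>. R v w)}"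

lemma dowker_complex_image:
  assumes "\<phi> ` V \<subseteq> V'" "\<psi> ` W \<subseteq> W'" "\<And>v w. R v w \<Longrightarrow> R' (\<phi> v) (\<psi> w)"
    and "\<sigma> \<in> dowker_complex V W R"
  shows "\<phi> ` \<sigma> \<in> dowker_complex V' W' R'"
proof -
  obtain w where "\<sigma> \<subseteq> V" "w \<in> W" "\<And>v. v \<in> \<sigma> \<Longrightarrow> R v w"
    using assms(4) by (auto simp: dowker_complex_def)
  then have "\<phi> ` \<sigma> \<subseteq> V'" "\<psi> w \<in> W'" "\<forall>v\<in>\<phi> ` \<sigma>. R' v (\<psi> w)"
    using assms(1-3) by auto
  then show ?thesis by (auto simp: dowker_complex_def)
qed

lemma Union_biclique_complex: "\<Union>(biclique_complex V W R) = V <+> W"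
proof
  show "V <+> W \<subseteq> \<Union>(biclique_complex V W R)"
  proof
    fix u assume "u \<in> V <+> W"
    then have "{u} \<in> biclique_complex V W R" by (auto simp: biclique_complex_def)
    then show "u \<in> \<Union>(biclique_complex V W R)" by blast
  qed
qed (auto simp: biclique_complex_def)

lemma biclique_complex_down: "F \<in> biclique_complex V W R \<Longrightarrow> F' \<subseteq> F \<Longrightarrow> F' \<in> biclique_complex V W R"
  unfolding biclique_complex_def by blast

text \<open>Elements of \<open>W\<close> put no constraint on each other in a face. Hence an element
  related to all of \<sigma> can be added to every face lying over \<sigma>, which gives the
  apex.\<close>

lemma excision_Inl:
  assumes "comm_group G" "finite V" "finite W"
  shows "excision G Inl V (biclique_complex V W R) (dowker_complex V W R)"
proof -
  interpret comm_group G by fact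
  show ?thesis
  proof
    show "finite (\<Union>(biclique_complex V W R))"
      using assms by (simp add: Union_biclique_complex)
    show "Inl ` \<sigma> \<in> biclique_complex V W R" if "\<sigma> \<subseteq> V" for \<sigma>
      using that by (auto simp: biclique_complex_def)
    show "Inl -` F \<subseteq> V" if "F \<in> biclique_complex V W R" for F
      using that by (auto simp: biclique_complex_def)
    show "Inl -` F \<in> dowker_complex V W R" if F: "F \<in> biclique_complex V W R" "\<not> F \<subseteq> range Inl" for F
    proof -
      obtain u where u: "u \<in> F" "u \<notin> range Inl" using F(2) by blast
      then obtain w where "u = Inr w" by (cases u) auto
      with u F(1) have "w \<in> W" "\<forall>v\<in>Inl -` F. R v w" "Inl -` F \<subseteq> V"
        by (auto simp: biclique_complex_def)
      then show ?thesis by (auto simp: dowker_complex_def)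
    qed
    show "\<exists>u\<in>\<Union>(biclique_complex V W R) - range Inl. \<forall>F\<in>biclique_complex V W R.
        Inl -` F = \<sigma> \<longrightarrow> insert u F \<in> biclique_complex V W R"
      if \<sigma>: "\<sigma> \<in> dowker_complex V W R" for \<sigma>
    proof -
      obtain w where w: "w \<in> W" "\<forall>v\<in>\<sigma>. R v w" using \<sigma> by (auto simp: dowker_complex_def)
      then have "Inr w \<in> \<Union>(biclique_complex V W R) - range Inl"
        by (auto simp: Union_biclique_complex)
      then show ?thesis
        by (rule rev_bexI) (use w in \<open>auto simp: biclique_complex_def\<close>)
    qed
  qed (auto simp: dowker_complex_def intro: biclique_complex_down)
qed

text \<open>The same complex seen from its other side. It is not replaced by its mirror image on
  \<open>W + V\<close>, because both restrictions must start from the same cycles.\<close>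

lemma excision_Inr:
  assumes "comm_group G" "finite V" "finite W"
  shows "excision G Inr W (biclique_complex V W R) (dowker_complex W V (\<lambda>w v. R v w))"
proof -
  interpret comm_group G by fact
  show ?thesis
  proof
    show "finite (\<Union>(biclique_complex V W R))"
      using assms by (simp add: Union_biclique_complex)
    show "Inr ` \<sigma> \<in> biclique_complex V W R" if "\<sigma> \<subseteq> W" for \<sigma>
      using that by (auto simp: biclique_complex_def)
    show "Inr -` F \<subseteq> W" if "F \<in> biclique_complex V W R" for F
      using that by (auto simp: biclique_complex_def)
    show "Inr -` F \<in> dowker_complex W V (\<lambda>w v. R v w)"
      if F: "F \<in> biclique_complex V W R" "\<not> F \<subseteq> range Inr" for F
    proof -
      obtain u where u: "u \<in> F" "u \<notin> range Inr" using F(2) by blast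
      then obtain v where "u = Inl v" by (cases u) auto
      with u F(1) have "v \<in> V" "\<forall>w\<in>Inr -` F. R v w" "Inr -` F \<subseteq> W"
        by (auto simp: biclique_complex_def)
      then show ?thesis by (auto simp: dowker_complex_def)
    qed
    show "\<exists>u\<in>\<Union>(biclique_complex V W R) - range Inr. \<forall>F\<in>biclique_complex V W R.
        Inr -` F = \<sigma> \<longrightarrow> insert u F \<in> biclique_complex V W R"
      if \<sigma>: "\<sigma> \<in> dowker_complex W V (\<lambda>w v. R v w)" for \<sigma>
    proof -
      obtain v where v: "v \<in> V" "\<forall>w\<in>\<sigma>. R v w" using \<sigma> by (auto simp: dowker_complex_def)
      then have "Inl v \<in> \<Union>(biclique_complex V W R) - range Inr"
        by (auto simp: Union_biclique_complex)
      then show ?thesis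
        by (rule rev_bexI) (use v in \<open>auto simp: biclique_complex_def\<close>)
    qed
  qed (auto simp: dowker_complex_def intro: biclique_complex_down)
qed

section \<open>Graphs and bipartitions\<close>

definition unsplit :: "'a set \<Rightarrow> 'a set set \<Rightarrow> bool" where
  "unsplit e P \<longleftrightarrow> (\<exists>U\<in>P. e \<subseteq> U)"

lemma bipartitionsE:
  assumes "P \<in> bipartitions A"
  obtains U U' where "P = {U, U'}" "U \<inter> U' = {}" "U \<union> U' = A" "U \<noteq> {}" "U' \<noteq> {}"
proof -
  have P: "partition_on A P" "card P = 2" using assms by (auto simp: bipartitions_def)
  then obtain U U' where U: "P = {U, U'}" "U \<noteq> U'" by (auto simp: card_2_iff)
  have "disjoint P" "\<Union>P = A" "{} \<notin> P" using P(1) by (auto simp: partition_on_def)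
  then show ?thesis using U that[of U U'] by (auto simp: disjoint_def)
qed

lemma bipartitionI:
  assumes "U \<inter> U' = {}" "U \<union> U' = A" "U \<noteq> {}" "U' \<noteq> {}"
  shows "{U, U'} \<in> bipartitions A"
proof -
  have "U \<noteq> U'" using assms by auto
  then show ?thesis using assms by (auto simp: bipartitions_def partition_on_def disjoint_def)
qed

lemma two_subsetsE:
  assumes "e \<in> two_subsets A"
  obtains a b where "e = {a, b}" "a \<noteq> b" "a \<in> A" "b \<in> A"
  using assms by (auto simp: two_subsets_def card_2_iff)

text \<open>No edge leaves the set of points reachable from \<open>a\<close>, so this set and its
  complement form the bipartition. Conversely, a chain of unsplit edges never leaves the part it
  starts in.\<close>

lemma nonconnected_iff:
  assumes "E \<subseteq> two_subsets A"
  shows "\<not> connected_graph A E \<longleftrightarrow> (\<exists>P\<in>bipartitions A. \<forall>e\<in>E. unsplit e P)"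
proof
  let ?r = "{(x, y). {x, y} \<in> E}"
  assume "\<not> connected_graph A E"
  then obtain a b where ab: "a \<in> A" "b \<in> A" "(a, b) \<notin> ?r\<^sup>*" by (auto simp: connected_graph_def)
  define U where "U = {x \<in> A. (a, x) \<in> ?r\<^sup>*}"
  have P: "{U, A - U} \<in> bipartitions A"
    using ab by (intro bipartitionI) (auto simp: U_def)
  have "unsplit e {U, A - U}" if "e \<in> E" for e
  proof -
    have "e \<in> two_subsets A" using that assms by blast
    then obtain x y where e: "e = {x, y}" "x \<noteq> y" "x \<in> A" "y \<in> A" by (rule two_subsetsE)
    then have "(x, y) \<in> ?r" "(y, x) \<in> ?r" using that by (simp_all add: insert_commute)
    then have "(a, x) \<in> ?r\<^sup>* \<longleftrightarrow> (a, y) \<in> ?r\<^sup>*" by (meson rtrancl.rtrancl_into_rtrancl)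
    then show ?thesis using e by (auto simp: unsplit_def U_def)
  qed
  then show "\<exists>P\<in>bipartitions A. \<forall>e\<in>E. unsplit e P" using P by blast
next
  let ?r = "{(x, y). {x, y} \<in> E}"
  assume "\<exists>P\<in>bipartitions A. \<forall>e\<in>E. unsplit e P"
  then obtain P where P: "P \<in> bipartitions A" "\<And>e. e \<in> E \<Longrightarrow> unsplit e P" by blast
  obtain U U' where U: "P = {U, U'}" "U \<inter> U' = {}" "U \<union> U' = A" "U \<noteq> {}" "U' \<noteq> {}"
    using P(1) by (rule bipartitionsE)
  obtain a b where ab: "a \<in> U" "b \<in> U'" using U by blast
  have "x \<in> U" if "(a, x) \<in> ?r\<^sup>*" for x
    using that
  proof induction
    case base
    show ?case by (rule ab(1))
  next
    case (step y z)
    then have "unsplit {y, z} P" using P(2) by simp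
    then show ?case using step.IH U(2) by (auto simp: U(1) unsplit_def)
  qed
  then have "(a, b) \<notin> ?r\<^sup>*" using ab(2) U(2) by blast
  moreover have "a \<in> A" "b \<in> A" using ab U(3) by auto
  ultimately show "\<not> connected_graph A E" by (auto simp: connected_graph_def)
qed

lemma nonconnected_graphs_dowker:
  "nonconnected_graphs A = dowker_complex (two_subsets A) (bipartitions A) unsplit"
  using nonconnected_iff by (auto simp: nonconnected_graphs_def graph_simplex_def dowker_complex_def)

lemma non_complete_iff: "non_complete A S \<longleftrightarrow> (\<exists>e\<in>two_subsets A. \<forall>P\<in>S. unsplit e P)"
proof
  assume "non_complete A S"
  then obtain a b where "a \<in> A" "b \<in> A" "a \<noteq> b" "\<forall>P\<in>S. \<exists>U\<in>P. a \<in> U \<and> b \<in> U"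
    by (auto simp: non_complete_def)
  then show "\<exists>e\<in>two_subsets A. \<forall>P\<in>S. unsplit e P"
    by (intro bexI[of _ "{a, b}"]) (auto simp: unsplit_def two_subsets_def)
next
  assume "\<exists>e\<in>two_subsets A. \<forall>P\<in>S. unsplit e P"
  then obtain e where e: "e \<in> two_subsets A" "\<forall>P\<in>S. unsplit e P" by blast
  obtain a b where "e = {a, b}" "a \<noteq> b" "a \<in> A" "b \<in> A" using e(1) by (rule two_subsetsE)
  then show "non_complete A S" using e(2) unfolding non_complete_def unsplit_def by auto
qed

lemma non_complete_faces_dowker:
  "non_complete_faces A = dowker_complex (bipartitions A) (two_subsets A) (\<lambda>P e. unsplit e P)"
  by (auto simp: non_complete_faces_def partition_simplex_def dowker_complex_def non_complete_iff)

lemma finite_two_subsets: "finite A \<Longrightarrow> finite (two_subsets A)"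
  by (rule finite_subset[of _ "Pow A"]) (auto simp: two_subsets_def)

lemma finite_bipartitions: "finite A \<Longrightarrow> finite (bipartitions A)"
  by (rule finite_subset[of _ "Pow (Pow A)"]) (auto simp: bipartitions_def partition_on_def)

definition unsplit_complex :: "'a set \<Rightarrow> ('a set + 'a set set) set set" where
  "unsplit_complex A = biclique_complex (two_subsets A) (bipartitions A) unsplit"

lemma Union_unsplit_complex: "\<Union>(unsplit_complex A) = two_subsets A <+> bipartitions A"
  by (simp add: unsplit_complex_def Union_biclique_complex)

lemma K_excision:
  assumes "comm_group G" "finite A"
  shows "excision G Inl (two_subsets A) (unsplit_complex A) (nonconnected_graphs A)"
  unfolding unsplit_complex_def nonconnected_graphs_dowker
  using assms by (intro excision_Inl finite_two_subsets finite_bipartitions)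

lemma C_excision:
  assumes "comm_group G" "finite A"
  shows "excision G Inr (bipartitions A) (unsplit_complex A) (non_complete_faces A)"
  unfolding unsplit_complex_def non_complete_faces_dowker
  using assms by (intro excision_Inr finite_two_subsets finite_bipartitions)

section \<open>The isomorphism\<close>

abbreviation K_class where
  "K_class G A n z \<equiv> hclass G (graph_simplex A) (nonconnected_graphs A) n (restr Inl z)"

abbreviation C_class where
  "C_class G A n z \<equiv> hclass G (partition_simplex A) (non_complete_faces A) n (restr Inr z)"

text \<open>This is \<open>\<phi>\<close> of \<open>iso_common_kernel\<close>, written out so that
  it is one function of \<open>G\<close>, \<open>A\<close> and \<open>n\<close>, as naturality
  compares its values at different arguments.\<close>

definition partitions_to_graphs ::
  "('g, 'm) monoid_scheme \<Rightarrow> 'a set \<Rightarrow> int \<Rightarrow> ('a set set list \<Rightarrow> 'g) set set \<Rightarrow> ('a set list \<Rightarrow> 'g) set set" where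
  "partitions_to_graphs G A n x =
     K_class G A n (SOME z. z \<in> carrier (cycle_group G (unsplit_complex A) n) \<and> C_class G A n z = x)"

context
  fixes G :: "('g, 'm) monoid_scheme" and A :: "'a set"
  assumes G: "comm_group G" and A: "finite A"
begin

interpretation K: excision G Inl "two_subsets A" "unsplit_complex A" "nonconnected_graphs A"
  by (rule K_excision[OF G A])

interpretation C: excision G Inr "bipartitions A" "unsplit_complex A" "non_complete_faces A"
  by (rule C_excision[OF G A])

lemma C_homology_class:
  assumes "x \<in> carrier (C_homology G A n)"
  obtains z where "z \<in> carrier (cycle_group G (unsplit_complex A) n)" "x = C_class G A n z"
  using assms C.hclass_restr_surj[of n] unfolding C_homology_def partition_simplex_def by blast

lemma
  shows partitions_to_graphs_iso: "partitions_to_graphs G A n \<in> iso (C_homology G A n) (K_homology G A n)"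
    and partitions_to_graphs_class: "z \<in> carrier (cycle_group G (unsplit_complex A) n) \<Longrightarrow>
      partitions_to_graphs G A n (C_class G A n z) = K_class G A n z"
proof -
  note defs = C_homology_def K_homology_def partition_simplex_def graph_simplex_def
  have C: "group_hom (cycle_group G (unsplit_complex A) n) (C_homology G A n) (C_class G A n)"
    "C_class G A n ` carrier (cycle_group G (unsplit_complex A) n) = carrier (C_homology G A n)"
    unfolding defs by (rule C.hclass_restr_hom, rule C.hclass_restr_surj)
  have K: "group_hom (cycle_group G (unsplit_complex A) n) (K_homology G A n) (K_class G A n)"
    "K_class G A n ` carrier (cycle_group G (unsplit_complex A) n) = carrier (K_homology G A n)"
    unfolding defs by (rule K.hclass_restr_hom, rule K.hclass_restr_surj)
  \<comment> \<open>Both sides are equivalent to \<open>z\<close> being a boundary in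
    \<open>unsplit_complex A\<close>.\<close>
  have ker: "C_class G A n z = \<one>\<^bsub>C_homology G A n\<^esub> \<longleftrightarrow> K_class G A n z = \<one>\<^bsub>K_homology G A n\<^esub>"
    if "z \<in> carrier (cycle_group G (unsplit_complex A) n)" for z
    unfolding defs
    by (simp only: C.hclass_restr_kernel[OF that] K.hclass_restr_kernel[OF that])
  show "partitions_to_graphs G A n \<in> iso (C_homology G A n) (K_homology G A n)"
    unfolding partitions_to_graphs_def[abs_def] using iso_common_kernel(1)[OF C K ker] .
  show "partitions_to_graphs G A n (C_class G A n z) = K_class G A n z"
    if "z \<in> carrier (cycle_group G (unsplit_complex A) n)"
    unfolding partitions_to_graphs_def using iso_common_kernel(2)[OF C K ker that] .
qed

end

section \<open>Naturality of the isomorphism\<close>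

lemma unsplit_image: "unsplit e P \<Longrightarrow> unsplit (f ` e) (image f ` P)"
  by (auto simp: unsplit_def)

text \<open>Lift \<open>x\<close> to a cycle \<open>z\<close> and push \<open>z\<close> along
  \<open>f\<close>: the result restricts to the pushed classes on both sides at once. As
  \<open>partitions_to_graphs_class\<close> holds for every lift, the lifts chosen over
  \<open>A\<close> and over \<open>B\<close> need not be related.\<close>

lemma partitions_to_graphs_bij:
  assumes G: "comm_group G" and A: "finite A" and B: "finite B" and f: "bij_betw f A B"
    and x: "x \<in> carrier (C_homology G A n)"
  shows "partitions_to_graphs G B n (C_bij_map G A B f n x) = K_bij_map G A B f n (partitions_to_graphs G A n x)"
proof -
  obtain z where z: "z \<in> carrier (cycle_group G (unsplit_complex A) n)" and x: "x = C_class G A n z"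
    using C_homology_class[OF G A x] .
  have f': "inj_on f A" "f ` A = B" using f by (auto simp: bij_betw_def)
  let ?\<phi> = "image f" and ?\<psi> = "image (image f)"
  let ?\<theta> = "map_sum ?\<phi> ?\<psi>"
  have inj1: "inj_on ?\<phi> (Pow A)" using f'(1) by (rule inj_on_image_Pow)
  then have inj2: "inj_on ?\<psi> (Pow (Pow A))" by (rule inj_on_image_Pow)
  have sub: "two_subsets A \<subseteq> Pow A" "bipartitions A \<subseteq> Pow (Pow A)"
    by (auto simp: two_subsets_def bipartitions_def partition_on_def)
  have \<phi>: "inj_on ?\<phi> (two_subsets A)" "?\<phi> ` two_subsets A \<subseteq> two_subsets B"
    using inj1 sub(1) f' by (auto simp: two_subsets_def card_image inj_on_subset intro: inj_on_subset)
  have \<psi>: "inj_on ?\<psi> (bipartitions A)" "?\<psi> ` bipartitions A \<subseteq> bipartitions B"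
  proof -
    show "inj_on ?\<psi> (bipartitions A)" using inj2 sub(2) by (rule inj_on_subset)
    show "?\<psi> ` bipartitions A \<subseteq> bipartitions B"
    proof
      fix Q assume "Q \<in> ?\<psi> ` bipartitions A"
      then obtain P where P: "P \<in> bipartitions A" "Q = image f ` P" by blast
      obtain U U' where U: "P = {U, U'}" "U \<inter> U' = {}" "U \<union> U' = A" "U \<noteq> {}" "U' \<noteq> {}"
        using P(1) by (rule bipartitionsE)
      have "f ` U \<inter> f ` U' = f ` (U \<inter> U')"
        using f'(1) U(3) by (intro inj_on_image_Int[symmetric]) auto
      then have "{f ` U, f ` U'} \<in> bipartitions B"
        using U f'(2) by (intro bipartitionI) auto
      then show "Q \<in> bipartitions B" by (simp add: P(2) U(1))
    qed
  qed
  note Un = Union_unsplit_complex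
  have \<theta>: "inj_on ?\<theta> (\<Union>(unsplit_complex A))"
    "?\<theta> ` \<Union>(unsplit_complex A) \<subseteq> \<Union>(unsplit_complex B)"
  proof -
    show "inj_on ?\<theta> (\<Union>(unsplit_complex A))"
    proof (rule inj_onI)
      fix u u' assume "u \<in> \<Union>(unsplit_complex A)" "u' \<in> \<Union>(unsplit_complex A)" "?\<theta> u = ?\<theta> u'"
      then show "u = u'"
        unfolding Un by (cases u; cases u') (auto dest: inj_onD[OF \<phi>(1)] inj_onD[OF \<psi>(1)])
    qed
    show "?\<theta> ` \<Union>(unsplit_complex A) \<subseteq> \<Union>(unsplit_complex B)"
      unfolding Un using subsetD[OF \<phi>(2) imageI] subsetD[OF \<psi>(2) imageI] by fastforce
  qed
  have \<theta>_face: "?\<theta> ` F \<in> unsplit_complex B" if "F \<in> unsplit_complex A" for F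
  proof -
    have F: "F \<subseteq> two_subsets A <+> bipartitions A" "\<And>e P. Inl e \<in> F \<Longrightarrow> Inr P \<in> F \<Longrightarrow> unsplit e P"
      using that by (auto simp: unsplit_complex_def biclique_complex_def)
    have "?\<theta> ` F \<subseteq> ?\<theta> ` \<Union>(unsplit_complex A)"
      using that by (intro image_mono Union_upper)
    also have "\<dots> \<subseteq> two_subsets B <+> bipartitions B"
      using \<theta>(2) by (simp only: Un)
    finally have "?\<theta> ` F \<subseteq> two_subsets B <+> bipartitions B" .
    moreover have "unsplit e' P'" if e': "Inl e' \<in> ?\<theta> ` F" and P': "Inr P' \<in> ?\<theta> ` F" for e' P'
    proof -
      obtain u where u: "Inl e' = ?\<theta> u" "u \<in> F" using e' by (rule imageE)
      obtain u' where u': "Inr P' = ?\<theta> u'" "u' \<in> F" using P' by (rule imageE)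
      obtain e where e: "u = Inl e" "e' = ?\<phi> e" using u(1) by (cases u) auto
      obtain P where P: "u' = Inr P" "P' = ?\<psi> P" using u'(1) by (cases u') auto
      have "unsplit e P" using F(2) u(2) u'(2) e(1) P(1) by simp
      then show ?thesis unfolding e(2) P(2) by (rule unsplit_image)
    qed
    ultimately show ?thesis by (simp add: unsplit_complex_def biclique_complex_def)
  qed
  have \<phi>_face: "?\<phi> ` \<sigma> \<in> nonconnected_graphs B" if "\<sigma> \<in> nonconnected_graphs A" for \<sigma>
    using that unfolding nonconnected_graphs_dowker
    by (rule dowker_complex_image[OF \<phi>(2) \<psi>(2), rotated]) (rule unsplit_image)
  have \<psi>_face: "?\<psi> ` \<sigma> \<in> non_complete_faces B" if "\<sigma> \<in> non_complete_faces A" for \<sigma>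
    using that unfolding non_complete_faces_dowker
    by (rule dowker_complex_image[OF \<psi>(2) \<phi>(2), rotated]) (rule unsplit_image)
  let ?z = "simp_push G (unsplit_complex A) ?\<theta> z"
  have z': "?z \<in> carrier (cycle_group G (unsplit_complex B) n)"
  proof (rule push_cycle[OF G \<theta> \<theta>_face _ _ z])
    show "F' \<in> unsplit_complex A" if "F \<in> unsplit_complex A" "F' \<subseteq> F" for F F'
      using that unfolding unsplit_complex_def by (rule biclique_complex_down)
    show "finite (\<Union>(unsplit_complex B))"
      using B by (simp add: Un finite_two_subsets finite_bipartitions)
  qed
  have "C_bij_map G A B f n x = C_class G B n ?z"
    unfolding C_bij_map_def x partition_simplex_def
  proof (rule quot_homology_map_push_restr[OF C_excision[OF G A] C_excision[OF G B] \<psi> \<psi>_face \<theta> \<theta>_face _ _ z])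
    \<comment> \<open>The separation of vertices needed to commute restriction with pushing:
      \<open>map_sum\<close> preserves the summand.\<close>
    show "u \<in> Inr ` bipartitions A" if "u \<in> \<Union>(unsplit_complex A)" "?\<theta> u \<in> range Inr" for u
      using that unfolding Un by (cases u) auto
  qed simp_all
  moreover have "K_bij_map G A B f n (K_class G A n z) = K_class G B n ?z"
    unfolding K_bij_map_def graph_simplex_def
  proof (rule quot_homology_map_push_restr[OF K_excision[OF G A] K_excision[OF G B] \<phi> \<phi>_face \<theta> \<theta>_face _ _ z])
    show "u \<in> Inl ` two_subsets A" if "u \<in> \<Union>(unsplit_complex A)" "?\<theta> u \<in> range Inl" for u
      using that unfolding Un by (cases u) auto
  qed simp_all
  ultimately show ?thesis
    by (simp only: x partitions_to_graphs_class[OF G A z] partitions_to_graphs_class[OF G B z'])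
qed

text \<open>As for bijections, with \<open>h \<circ> z\<close> as the common lift; composing with
  \<open>h\<close> on the left commutes with restriction, which composes on the right.\<close>

lemma partitions_to_graphs_coeff:
  assumes G: "comm_group G" and G': "comm_group G'" and h: "h \<in> hom G G'" and A: "finite A"
    and x: "x \<in> carrier (C_homology G A n)"
  shows "partitions_to_graphs G' A n (C_coeff_map G' h A n x) = K_coeff_map G' h A n (partitions_to_graphs G A n x)"
proof -
  obtain z where z: "z \<in> carrier (cycle_group G (unsplit_complex A) n)" and x: "x = C_class G A n z"
    using C_homology_class[OF G A x] .
  note z' = hom_cycle[OF G G' h z]
  have "C_coeff_map G' h A n x = C_class G' A n (h \<circ> z)"
    unfolding C_coeff_map_def x partition_simplex_def
    by (rule quot_homology_map_hom_restr[OF G G' h C_excision[OF G A] C_excision[OF G' A] z])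
  moreover have "K_coeff_map G' h A n (K_class G A n z) = K_class G' A n (h \<circ> z)"
    unfolding K_coeff_map_def graph_simplex_def
    by (rule quot_homology_map_hom_restr[OF G G' h K_excision[OF G A] K_excision[OF G' A] z])
  ultimately show ?thesis
    by (simp only: x partitions_to_graphs_class[OF G A z] partitions_to_graphs_class[OF G' A z'])
qed

theorem theorem3:
  shows "\<exists>\<Phi> :: 'g monoid \<Rightarrow> 'a set \<Rightarrow> int \<Rightarrow>
            ('a set set list \<Rightarrow> 'g) set set \<Rightarrow> ('a set list \<Rightarrow> 'g) set set.
      (\<forall>G A n. comm_group G \<and> finite A \<longrightarrow>
         \<Phi> G A n \<in> iso (C_homology G A n) (K_homology G A n)) \<and>
      (\<forall>G A B f n. comm_group G \<and> finite A \<and> finite B \<and> bij_betw f A B \<longrightarrow>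
         (\<forall>x \<in> carrier (C_homology G A n).
            \<Phi> G B n (C_bij_map G A B f n x) = K_bij_map G A B f n (\<Phi> G A n x))) \<and>
      (\<forall>G G' h A n. comm_group G \<and> comm_group G' \<and> h \<in> hom G G' \<and> finite A \<longrightarrow>
         (\<forall>x \<in> carrier (C_homology G A n).
            \<Phi> G' A n (C_coeff_map G' h A n x) = K_coeff_map G' h A n (\<Phi> G A n x)))"
proof (intro exI[of _ partitions_to_graphs] conjI allI impI ballI; elim conjE)
qed (rule partitions_to_graphs_iso partitions_to_graphs_bij partitions_to_graphs_coeff; assumption)+

end
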